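(* Let $b \ge 2$ be an integer and $\xi$ an irrational real number, and let $\mu$ denote the irrationality exponent of $\xi$. If $\mu = 2$, then $$\limsup_{n \to +\infty} \frac{p(n,\xi,b)}{n} \ge \frac{4}{3}.$$ If $\mu > 2$, then $$\limsup_{n \to +\infty} \frac{p(n,\xi,b)}{n} \ge 1 + \frac{\mu + 1 - \sqrt{81(\mu-2)^2 - 10\mu + 29}}{8(\mu-2)}.$$
   Context: The irrationality exponent $\mu(\xi)$ of an irrational real $\xi$ is the supremum of the real numbers $\mu$ such that $|\xi - p/q| < q^{-\mu}$ has infinitely many rational solutions $p/q$ with $q \ge 1$. The $b$-ary expansion of $\xi$ is the unique sequence $(x_j)_{j\ge1}$ with $x_j \in \{0,1,\dots,b-1\}$, $x_j \ne b-1$ for infinitely many $j$, and $\xi = \lfloor \xi \rfloor + \sum_{j \ge 1} x_j b^{-j}$. For an infinite word $\mathbf x = x_1x_2\dots$, $p(n,\mathbf x)$ denotes the number of distinct blocks $x_{j+1}\dots x_{j+n}$ ($j \ge 0$) of length $n$ in $\mathbf x$, and $p(n,\xi,b) := p(n,\mathbf x)$ where $\mathbf x$ is the $b$-ary expansion of $\xi$. *)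

theory Defs
  imports Complex_Main "HOL-Library.Extended_Real"
begin

text \<open>
  The solutions are counted as rational numbers, not as pairs \<open>(p, q)\<close>. The supremum is
  taken in \<open>ereal\<close>, because it is infinite for Liouville numbers.
\<close>

definition irrationality_exponent :: "real \<Rightarrow> ereal" where
  "irrationality_exponent \<xi> =
     Sup {ereal \<mu> | \<mu> :: real.
       infinite {real_of_int p / real q | (p :: int) (q :: nat).
         q \<ge> 1 \<and> \<bar>\<xi> - real_of_int p / real q\<bar> < real q powr (- \<mu>)}}"

text \<open>
  Infinite words are indexed from \<open>0\<close>, so \<open>x j\<close> is the digit \<open>x\<^sub>j\<^sub>+\<^sub>1\<close> of weight \<open>b\<close> to the
  power \<open>-(j + 1)\<close>.
\<close>

definition is_expansion :: "nat \<Rightarrow> real \<Rightarrow> (nat \<Rightarrow> nat) \<Rightarrow> bool" where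
  "is_expansion b \<xi> x \<longleftrightarrow>
     (\<forall>j. x j \<in> {0..b - 1}) \<and>
     infinite {j. x j \<noteq> b - 1} \<and>
     \<xi> = of_int \<lfloor>\<xi>\<rfloor> + (\<Sum>j. real (x j) / real b ^ (j + 1))"

definition expansion :: "nat \<Rightarrow> real \<Rightarrow> nat \<Rightarrow> nat" where
  "expansion b \<xi> = (THE x. is_expansion b \<xi> x)"

definition blocks :: "nat \<Rightarrow> (nat \<Rightarrow> 'a) \<Rightarrow> 'a list set" where
  "blocks n x = {map x [j..<j + n] | j. True}"

definition block_complexity :: "nat \<Rightarrow> (nat \<Rightarrow> 'a) \<Rightarrow> nat" where
  "block_complexity n x = card (blocks n x)"

definition real_complexity :: "nat \<Rightarrow> real \<Rightarrow> nat \<Rightarrow> nat" where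
  "real_complexity n \<xi> b = block_complexity n (expansion b \<xi>)"

lemma digit_tail_bounds:
  assumes b: "b \<ge> 2" and d: "\<And>j. x j \<in> {0..b - 1}" and i: "infinite {j. x j \<noteq> b - 1}"
  shows "summable (\<lambda>j. real (x j) / real b ^ (j + 1))"
    and "0 \<le> (\<Sum>j. real (x j) / real b ^ (j + 1))"
    and "(\<Sum>j. real (x j) / real b ^ (j + 1)) < 1"
proof -
  let ?f = "\<lambda>j. real (x j) / real b ^ (j + 1)"
  let ?g = "\<lambda>j. (real b - 1) / real b * (1 / real b) ^ j"
  have g: "?g sums ((real b - 1) / real b * (1 / (1 - 1 / real b)))"
    by (intro sums_mult geometric_sums) (use b in auto)
  have g1: "(real b - 1) / real b * (1 / (1 - 1 / real b)) = 1"
    using b by (simp add: field_simps)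
  have dd: "real (x j) \<le> real b - 1" for j
    using d[of j] b by (auto simp: of_nat_diff)
  have le: "?f j \<le> ?g j" for j
    using dd[of j] b by (simp add: power_divide divide_right_mono)
  show s: "summable ?f"
    by (rule summable_comparison_test'[OF sums_summable[OF g], of 0]) (use le in auto)
  show "0 \<le> suminf ?f"
    by (rule suminf_nonneg[OF s]) auto
  obtain k where k: "x k \<noteq> b - 1"
    using i by (metis (mono_tags, lifting) Collect_empty_eq finite.emptyI)
  hence "x k < b - 1" using d[of k] by auto
  hence "real (x k) < real b - 1" using b by linarith
  hence lt: "?f k < ?g k"
    using b by (simp add: power_divide divide_strict_right_mono)
  have sg: "summable ?g" using g by (rule sums_summable)
  have "0 < (\<Sum>j. ?g j - ?f j)"
    by (rule suminf_pos2[where i = k])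
      (use le lt summable_diff[OF sg s] in auto)
  thus "suminf ?f < 1"
    using suminf_diff[OF sg s] sums_unique[OF g] g1 by linarith
qed

lemma expansion_unique_digit:
  assumes b: "b \<ge> 2" and x: "is_expansion b \<xi> x"
  shows "x n = nat (\<lfloor>real b ^ (n + 1) * frac \<xi>\<rfloor> mod int b)"
proof -
  let ?f = "\<lambda>j. real (x j) / real b ^ (j + 1)"
  have d: "x j \<in> {0..b - 1}" for j
    using x by (auto simp: is_expansion_def)
  have i: "infinite {j. x j \<noteq> b - 1}" and e: "frac \<xi> = suminf ?f"
    using x by (auto simp: is_expansion_def frac_def)
  define N where "N m = (\<Sum>j<m. x j * b ^ (m - 1 - j))" for m
  have fl: "\<lfloor>real b ^ m * frac \<xi>\<rfloor> = int (N m)" for m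
  proof -
    let ?y = "\<lambda>j. x (j + m)"
    have iy: "infinite {j. ?y j \<noteq> b - 1}"
    proof
      assume "finite {j. ?y j \<noteq> b - 1}"
      hence "finite ((\<lambda>j. j + m) ` {j. ?y j \<noteq> b - 1} \<union> {..<m})" by auto
      moreover have "{j. x j \<noteq> b - 1} \<subseteq> (\<lambda>j. j + m) ` {j. ?y j \<noteq> b - 1} \<union> {..<m}"
      proof
        fix j assume "j \<in> {j. x j \<noteq> b - 1}"
        thus "j \<in> (\<lambda>j. j + m) ` {j. ?y j \<noteq> b - 1} \<union> {..<m}"
          by (cases "j < m") (auto intro!: image_eqI[of _ _ "j - m"])
      qed
      ultimately show False using i finite_subset by blast
    qed
    note B = digit_tail_bounds[OF b, of ?y, OF d iy]
    have "suminf ?f = (\<Sum>j. ?f (j + m)) + (\<Sum>j<m. ?f j)"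
      by (rule suminf_split_initial_segment[OF digit_tail_bounds(1)[OF b d i]])
    moreover have "(\<Sum>j. ?f (j + m)) = (\<Sum>j. real (?y j) / real b ^ (j + 1)) / real b ^ m"
      by (subst suminf_divide[OF B(1), symmetric]) (simp add: power_add mult_ac)
    moreover have "real b ^ m * (\<Sum>j<m. ?f j) = real (N m)"
    proof -
      have "real b ^ m * ?f j = real (x j * b ^ (m - 1 - j))" if "j < m" for j
      proof -
        have "real b ^ m = real b ^ (j + 1) * real b ^ (m - 1 - j)"
          using that by (subst power_add[symmetric]) simp
        thus ?thesis using b by simp
      qed
      thus ?thesis by (simp add: N_def sum_distrib_left)
    qed
    ultimately have "real b ^ m * frac \<xi> = real (N m) + (\<Sum>j. real (?y j) / real b ^ (j + 1))"
      using b e by (simp add: distrib_left)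
    thus ?thesis using B(2,3) by (intro floor_unique) auto
  qed
  have "N (n + 1) = x n + b * N n"
  proof -
    have "x j * b ^ (n - j) = b * (x j * b ^ (n - 1 - j))" if "j < n" for j
    proof -
      have "n - j = Suc (n - 1 - j)" using that by simp
      thus ?thesis by simp
    qed
    hence "(\<Sum>j<n. x j * b ^ (n - j)) = (\<Sum>j<n. b * (x j * b ^ (n - 1 - j)))"
      by (intro sum.cong) auto
    thus ?thesis by (simp add: N_def sum_distrib_left)
  qed
  moreover have "x n < b" using d[of n] b by auto
  ultimately have "N (n + 1) mod b = x n" by simp
  thus ?thesis by (subst fl) (simp add: zmod_int[symmetric])
qed

lemma expansion_exists:
  assumes b: "b \<ge> 2"
  shows "\<exists>x. is_expansion b \<xi> x"
proof -
  define F where "F m = \<lfloor>real b ^ m * frac \<xi>\<rfloor>" for m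
  define x where "x n = nat (F (n + 1) mod int b)" for n
  let ?f = "\<lambda>j. real (x j) / real b ^ (j + 1)"
  have d: "x j \<in> {0..b - 1}" for j
  proof -
    have "F (j + 1) mod int b < int b" using b by simp
    thus ?thesis unfolding x_def by auto
  qed
  have step: "F (n + 1) = int b * F n + int (x n)" for n
  proof -
    have "F n = \<lfloor>(real b ^ (n + 1) * frac \<xi>) / real b\<rfloor>"
      using b by (simp add: F_def)
    also have "\<dots> = F (n + 1) div int b"
      unfolding F_def by (metis floor_divide_real_eq_div of_int_of_nat_eq of_nat_0_le_iff)
    finally show ?thesis using b by (simp add: x_def)
  qed
  have part: "(\<Sum>j<m. ?f j) = real_of_int (F m) / real b ^ m" for m
  proof (induction m)
    case 0
    have "\<lfloor>frac \<xi>\<rfloor> = 0" by (simp add: floor_eq_iff frac_lt_1)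
    thus ?case by (simp add: F_def)
  next
    case (Suc m)
    have "real_of_int (F (Suc m)) = real b * real_of_int (F m) + real (x m)"
      using step[of m] by simp
    thus ?case using Suc b by (simp add: field_simps)
  qed
  have bound: "real_of_int (F m) \<le> real b ^ m * frac \<xi>"
    "real b ^ m * frac \<xi> < real_of_int (F m) + 1" for m
    unfolding F_def by linarith+
  have z: "(\<lambda>m. (1 / real b) ^ m) \<longlonglongrightarrow> 0"
    using b by (intro LIMSEQ_power_zero) simp
  have "(\<lambda>m. frac \<xi> - (\<Sum>j<m. ?f j)) \<longlonglongrightarrow> 0"
  proof (rule tendsto_sandwich[OF _ _ tendsto_const z])
    show "\<forall>\<^sub>F m in sequentially. 0 \<le> frac \<xi> - (\<Sum>j<m. ?f j)"
      using b bound(1) by (intro always_eventually allI, subst part) (simp add: field_simps)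
    show "\<forall>\<^sub>F m in sequentially. frac \<xi> - (\<Sum>j<m. ?f j) \<le> (1 / real b) ^ m"
    proof (intro always_eventually allI)
      fix m
      have "real b ^ m * frac \<xi> \<le> real_of_int (F m) + 1" using bound(2)[of m] by simp
      hence "frac \<xi> \<le> (real_of_int (F m) + 1) / real b ^ m"
        using b by (simp add: pos_le_divide_eq mult.commute)
      thus "frac \<xi> - (\<Sum>j<m. ?f j) \<le> (1 / real b) ^ m"
        by (subst part) (simp add: add_divide_distrib power_divide)
    qed
  qed
  hence "(\<lambda>m. frac \<xi> - (frac \<xi> - (\<Sum>j<m. ?f j))) \<longlonglongrightarrow> frac \<xi> - 0"
    by (intro tendsto_diff tendsto_const)
  hence "?f sums frac \<xi>" by (simp add: sums_def)
  hence e: "frac \<xi> = suminf ?f" by (rule sums_unique)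
  have "infinite {j. x j \<noteq> b - 1}"
  proof
    assume "finite {j. x j \<noteq> b - 1}"
    then obtain m where m: "\<And>j. j \<ge> m \<Longrightarrow> x j = b - 1"
      unfolding finite_nat_set_iff_bounded by (auto simp: not_less[symmetric])
    have inv: "real b ^ (m + k) * (frac \<xi> - (real_of_int (F m) + 1) / real b ^ m)
        = real b ^ (m + k) * frac \<xi> - (real_of_int (F (m + k)) + 1)" for k
    proof (induction k)
      case 0
      show ?case using b by (simp add: field_simps)
    next
      case (Suc k)
      have "real_of_int (F (m + Suc k)) = real b * real_of_int (F (m + k)) + (real b - 1)"
        using step[of "m + k"] m[of "m + k"] b by (simp add: of_nat_diff)
      thus ?case using arg_cong[OF Suc, of "\<lambda>t. real b * t"] by (simp add: algebra_simps)
    qed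
    define c where "c = (real_of_int (F m) + 1) / real b ^ m - frac \<xi>"
    have "c > 0" using bound(2)[of m] b by (simp add: c_def field_simps)
    have "real b ^ (m + k) * c \<le> 1" for k
      using inv[of k] bound(1)[of "m + k"] by (simp add: c_def right_diff_distrib)
    hence le: "c \<le> (1 / real b) ^ (m + k)" for k
      using b by (simp add: field_simps)
    obtain k where "(1 / real b) ^ k < c"
      using real_arch_pow_inv[OF \<open>c > 0\<close>, of "1 / real b"] b by auto
    moreover have "(1 / real b) ^ (m + k) \<le> (1 / real b) ^ k"
      using b by (intro power_decreasing) auto
    ultimately show False using le[of k] by linarith
  qed
  thus ?thesis using d e unfolding is_expansion_def frac_def by (intro exI[of _ x]) auto
qed

lemma is_expansion_expansion:
  assumes "b \<ge> 2"
  shows "is_expansion b \<xi> (expansion b \<xi>)"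
proof -
  obtain x where x: "is_expansion b \<xi> x"
    using expansion_exists[OF assms] by blast
  show ?thesis
    unfolding expansion_def
  proof (rule theI[of "is_expansion b \<xi>", OF x])
    fix y assume "is_expansion b \<xi> y"
    thus "y = x"
      using expansion_unique_digit[OF assms] x by (metis ext)
  qed
qed

end

theory Submission
  imports Defs
begin

text \<open>
  Suppose that the complexity satisfies \<open>p(m) \<le> (1 + r) m\<close> for large \<open>m\<close>, with \<open>r \<le> 1/3\<close>. Then
  \<open>p(n + 1) = p(n) + 1\<close> for infinitely many \<open>n\<close>, and after enlarging \<open>n\<close> suitably the Rauzy
  graph of order \<open>n\<close> consists of two loops through a single bispecial block, preceded by a path
  that is never entered again. The digit sequence follows these loops. A block of length \<open>L\<close>
  that occurs at the positions \<open>i < j\<close> produces a rational approximation with denominator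
  \<open>b\<^sup>j - b\<^sup>i\<close> and exponent about \<open>1 + L / j\<close>, so that an irrationality exponent below \<open>2 + s\<close>
  forces \<open>L \<le> (1 + s) j\<close> for all long repetitions. Applied to the repetitions among the first few
  loops, and combined with the bounds on the complexity (which is at least the number of vertices
  of the graph and grows with slope 2 as long as there are two right special blocks), this gives
  a system of linear inequalities without solution if \<open>s + 3/5 r \<le> 21/100\<close>. This line lies
  above the curve of the theorem.
\<close>

section \<open>Blocks and complexity\<close>

definition agree :: "(nat \<Rightarrow> 'a) \<Rightarrow> nat \<Rightarrow> nat \<Rightarrow> nat \<Rightarrow> bool" where
  "agree x n i j \<longleftrightarrow> (\<forall>k<n. x (i + k) = x (j + k))"

lemma agree_refl [simp]: "agree x n i i"
  by (simp add: agree_def)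

lemma agree_sym: "agree x n i j \<Longrightarrow> agree x n j i"
  by (simp add: agree_def)

lemma agree_trans: "agree x n i j \<Longrightarrow> agree x n j k \<Longrightarrow> agree x n i k"
  by (simp add: agree_def)

lemma agree_mono: "agree x n i j \<Longrightarrow> m \<le> n \<Longrightarrow> agree x m i j"
  by (simp add: agree_def)

lemma agreeD: "agree x n i j \<Longrightarrow> k < n \<Longrightarrow> x (i + k) = x (j + k)"
  by (simp add: agree_def)

lemma agree_Suc: "agree x (Suc n) i j \<longleftrightarrow> agree x n i j \<and> x (i + n) = x (j + n)"
  by (auto simp: agree_def less_Suc_eq)

lemma agree_add: "agree x (m + n) i j \<longleftrightarrow> agree x m i j \<and> agree x n (i + m) (j + m)"
proof (induction n)
  case (Suc n)
  thus ?case by (auto simp: agree_Suc add.assoc)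
qed (simp add: agree_def)

lemma agree_shift: "agree (\<lambda>k. x (s + k)) n i j \<longleftrightarrow> agree x n (s + i) (s + j)"
  by (simp add: agree_def add.assoc)

lemma map_upt_eq_iff: "map x [i..<i + n] = map x [j..<j + n] \<longleftrightarrow> agree x n i j"
  by (auto simp: agree_def list_eq_iff_nth_eq)

lemma finite_blocks:
  assumes "finite (range x)"
  shows "finite (blocks n x)"
  by (rule finite_subset[OF _ finite_lists_length_eq[OF assms, of n]]) (auto simp: blocks_def)

lemma card_le_complexity:
  assumes "finite (range x)" and "\<And>i j. i \<in> A \<Longrightarrow> j \<in> A \<Longrightarrow> agree x n i j \<Longrightarrow> i = j"
  shows "card A \<le> block_complexity n x"
  unfolding block_complexity_def
proof (rule card_inj_on_le[OF _ _ finite_blocks[OF assms(1)]])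
  show "inj_on (\<lambda>i. map x [i..<i + n]) A"
    using assms(2) by (auto simp: inj_on_def map_upt_eq_iff)
qed (auto simp: blocks_def)

text \<open>Every block of length \<open>n\<close> has a continuation, so the blocks of \<open>E\<close> that split contribute extra.\<close>

lemma complexity_Suc_ge:
  assumes fin: "finite (range x)" and E: "finite E"
    and dist: "\<And>i j. i \<in> E \<Longrightarrow> j \<in> E \<Longrightarrow> agree x (Suc n) i j \<Longrightarrow> i = j"
  shows "block_complexity n x + card E
    \<le> block_complexity (Suc n) x + card ((\<lambda>i. map x [i..<i + n]) ` E)"
proof -
  define w where "w m i = map x [i..<i + m]" for m i
  have w: "w m i = w m j \<longleftrightarrow> agree x m i j" for m i j
    by (simp add: w_def map_upt_eq_iff)
  have blocks: "blocks n x = range (w n)"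
    by (auto simp: blocks_def w_def)
  define B where "B = blocks n x - w n ` E"
  obtain g where g: "w n (g v) = v" if "v \<in> blocks n x" for v
    unfolding blocks by (metis f_inv_into_f)
  have B: "w n (g v) = v" "v \<notin> w n ` E" if "v \<in> B" for v
    using that g by (auto simp: B_def)
  \<comment> \<open>One position for each block of length \<open>n\<close> not occurring at
    \<open>E\<close>, together with all of \<open>E\<close>: no two of these positions carry the
    same block of length \<open>Suc n\<close>.\<close>
  define A where "A = g ` B \<union> E"
  have gB: "inj_on g B" by (rule inj_on_inverseI[of _ "w n"]) (rule B)
  have finB: "finite B" unfolding B_def by (rule finite_Diff[OF finite_blocks[OF fin]])
  have "g v \<notin> E" if "v \<in> B" for v
    using B[OF that] by (metis imageI)
  hence disj: "g ` B \<inter> E = {}" by blast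
  have cA: "card A = card B + card E"
    unfolding A_def card_Un_disjoint[OF finite_imageI[OF finB] E disj] card_image[OF gB] ..
  have cB: "card B = block_complexity n x - card (w n ` E)"
    unfolding B_def block_complexity_def
    by (rule card_Diff_subset) (use E blocks in auto)
  have "card A \<le> block_complexity (Suc n) x"
  proof (rule card_le_complexity[OF fin])
    fix i j assume ij: "i \<in> A" "j \<in> A" "agree x (Suc n) i j"
    hence e: "w n i = w n j" by (simp add: w agree_Suc)
    consider "i \<in> E" "j \<in> E" | v where "i \<in> E" "v \<in> B" "j = g v"
      | v where "j \<in> E" "v \<in> B" "i = g v" | v v' where "v \<in> B" "i = g v" "v' \<in> B" "j = g v'"
      using ij unfolding A_def by blast
    thus "i = j"
    proof cases
      case 1
      thus ?thesis using dist ij by blast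
    next
      case (2 v)
      thus ?thesis using e B[of v] by (metis imageI)
    next
      case (3 v)
      thus ?thesis using e B[of v] by (metis imageI)
    next
      case (4 v v')
      thus ?thesis using e B(1)[of v] B(1)[of v'] by metis
    qed
  qed
  thus ?thesis using cA cB unfolding w_def by linarith
qed

lemma complexity_Suc_branch:
  assumes fin: "finite (range x)" and "agree x n i j" "x (i + n) \<noteq> x (j + n)"
  shows "block_complexity n x + 1 \<le> block_complexity (Suc n) x"
proof -
  let ?E = "{i, j}"
  have "card ?E = 2" using assms by (auto simp: card_insert_if)
  moreover have "(\<lambda>i. map x [i..<i + n]) ` ?E = {map x [i..<i + n]}"
    using assms by (auto simp: map_upt_eq_iff dest: agree_sym)
  moreover have "block_complexity n x + card ?E
      \<le> block_complexity (Suc n) x + card ((\<lambda>i. map x [i..<i + n]) ` ?E)"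
    by (rule complexity_Suc_ge[OF fin]) (use assms in \<open>auto simp: agree_Suc dest: agree_sym\<close>)
  ultimately show ?thesis by simp
qed

lemma complexity_Suc_two_branches:
  assumes fin: "finite (range x)" and "agree x n i i'" "x (i + n) \<noteq> x (i' + n)"
    and "agree x n j j'" "x (j + n) \<noteq> x (j' + n)" and "\<not> agree x n i j"
  shows "block_complexity n x + 2 \<le> block_complexity (Suc n) x"
proof -
  let ?E = "{i, i', j, j'}"
  have n: "\<not> agree x n i j" "\<not> agree x n i j'" "\<not> agree x n i' j" "\<not> agree x n i' j'"
    using assms by (meson agree_sym agree_trans)+
  have "card ?E = 4" using assms n by (auto simp: card_insert_if)
  moreover have im: "(\<lambda>i. map x [i..<i + n]) ` ?E = {map x [i..<i + n], map x [j..<j + n]}"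
    using assms by (auto simp: map_upt_eq_iff dest: agree_sym)
  have "card ((\<lambda>i. map x [i..<i + n]) ` ?E) \<le> 2" unfolding im by (simp add: card_insert_if)
  moreover have "block_complexity n x + card ?E
      \<le> block_complexity (Suc n) x + card ((\<lambda>i. map x [i..<i + n]) ` ?E)"
    by (rule complexity_Suc_ge[OF fin]) (use assms n in \<open>auto simp: agree_Suc dest: agree_sym\<close>)
  ultimately show ?thesis by linarith
qed

lemma complexity_Suc_three_letters:
  assumes fin: "finite (range x)" and "agree x n i j" "agree x n i k"
    and "x (i + n) \<noteq> x (j + n)" "x (i + n) \<noteq> x (k + n)" "x (j + n) \<noteq> x (k + n)"
  shows "block_complexity n x + 2 \<le> block_complexity (Suc n) x"
proof -
  let ?E = "{i, j, k}"
  have "card ?E = 3" using assms by (auto simp: card_insert_if)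
  moreover have "(\<lambda>i. map x [i..<i + n]) ` ?E = {map x [i..<i + n]}"
    using assms by (auto simp: map_upt_eq_iff dest: agree_sym)
  moreover have "block_complexity n x + card ?E
      \<le> block_complexity (Suc n) x + card ((\<lambda>i. map x [i..<i + n]) ` ?E)"
    by (rule complexity_Suc_ge[OF fin]) (use assms in \<open>auto simp: agree_Suc dest: agree_sym\<close>)
  ultimately show ?thesis by simp
qed

text \<open>Suffixes of a right special block are right special. Since the letters at distance
  \<open>Suc l\<close> from the two ends differ, longer suffixes of the two blocks are distinct, and
  each of the \<open>d\<close> lengths adds at least 2.\<close>

lemma complexity_two_branches:
  assumes fin: "finite (range x)" and u: "agree x e u u'" "x (u + e) \<noteq> x (u' + e)"
    and v: "agree x f v v'" "x (v + f) \<noteq> x (v' + f)"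
    and w: "x (u + e - Suc l) \<noteq> x (v + f - Suc l)" and le: "l + d \<le> e" "l + d \<le> f"
  shows "block_complexity (Suc l) x + 2 * d \<le> block_complexity (Suc (l + d)) x"
  using le
proof (induction d)
  case (Suc d)
  let ?m = "Suc (l + d)"
  have shift: "agree x ?m (i + (g - ?m)) (j + (g - ?m))" if "agree x g i j" "?m \<le> g" for i j g
    using that agree_add[of x "g - ?m" ?m i j] by simp
  have "\<not> agree x ?m (u + (e - ?m)) (v + (f - ?m))"
  proof
    assume "agree x ?m (u + (e - ?m)) (v + (f - ?m))"
    from agreeD[OF this, of d] show False using w Suc.prems by simp
  qed
  hence "block_complexity ?m x + 2 \<le> block_complexity (Suc ?m) x"
    using Suc.prems u v
    by (intro complexity_Suc_two_branches[OF fin shift[OF u(1)] _ shift[OF v(1)]]) auto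
  thus ?case using Suc by simp
qed simp

section \<open>Words over a finite alphabet that are not eventually periodic\<close>

locale aperiodic_word =
  fixes x :: "nat \<Rightarrow> 'a"
  assumes fin: "finite (range x)"
    and aperiodic: "i < j \<Longrightarrow> \<exists>n. \<not> agree x n i j"
begin

text \<open>Otherwise two equal blocks beyond \<open>m\<close>, which exist by the pigeonhole
  principle, would be continued identically for ever.\<close>

lemma not_eventually_deterministic:
  "\<exists>i j. m \<le> i \<and> m \<le> j \<and> agree x n i j \<and> x (i + n) \<noteq> x (j + n)"
proof (rule ccontr)
  assume "\<not> ?thesis"
  hence det: "x (i + n) = x (j + n)" if "m \<le> i" "m \<le> j" "agree x n i j" for i j
    using that by blast
  let ?w = "\<lambda>i. map x [i..<i + n]"
  have "finite (?w ` {m..})"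
    by (rule finite_subset[OF _ finite_blocks[OF fin, of n]]) (auto simp: blocks_def)
  hence "\<not> inj_on ?w {m..}" using finite_imageD infinite_Ici by blast
  then obtain i j where ij: "m \<le> i" "i < j" "agree x n i j"
    by (auto simp: inj_on_def map_upt_eq_iff neq_iff dest: agree_sym)
  have "agree x n (i + k) (j + k)" for k
  proof (induction k)
    case (Suc k)
    hence "agree x (n + 1) (i + k) (j + k)"
      using det[of "i + k" "j + k"] ij by (simp add: agree_Suc)
    hence "agree x (1 + n) (i + k) (j + k)" by (simp add: add.commute)
    thus ?case unfolding agree_add by simp
  qed (use ij in simp)
  hence "x (i + k + n) = x (j + k + n)" for k using det[of "i + k" "j + k"] ij by simp
  hence "agree x k (i + n) (j + n)" for k by (simp add: agree_def ac_simps)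
  moreover obtain N where "\<not> agree x N (i + n) (j + n)"
    using aperiodic[of "i + n" "j + n"] ij by auto
  ultimately show False by blast
qed

lemma complexity_strict_mono: "block_complexity n x + 1 \<le> block_complexity (Suc n) x"
  using not_eventually_deterministic[of 0 n] complexity_Suc_branch[OF fin] by blast

lemma complexity_mono_add: "block_complexity n x + k \<le> block_complexity (n + k) x"
proof (induction k)
  case (Suc k)
  thus ?case using complexity_strict_mono[of "n + k"] by simp
qed simp

lemma complexity_ge: "n + 1 \<le> block_complexity n x"
proof -
  have "block_complexity 0 x = 1" by (simp add: block_complexity_def blocks_def)
  thus ?thesis using complexity_mono_add[of 0 n] by simp
qed

lemma aperiodic_shift: "aperiodic_word (\<lambda>k. x (s + k))"
proof
  show "finite (range (\<lambda>k. x (s + k)))" by (rule finite_subset[OF _ fin]) auto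
  show "\<exists>n. \<not> agree (\<lambda>k. x (s + k)) n i j" if "i < j" for i j
    using aperiodic[of "s + i" "s + j"] that by (simp add: agree_shift)
qed

end

section \<open>Rauzy graphs with two loops\<close>

text \<open>
  The Rauzy graph of order \<open>n\<close> looks like a figure eight: \<open>P\<close> is the set of occurrences of its
  only bispecial block, the two loops have lengths \<open>gap True\<close> and \<open>gap False\<close>, and \<open>ty i\<close> says
  which loop is entered at the occurrence \<open>i\<close>.
\<close>

locale figure_eight = aperiodic_word x for x :: "nat \<Rightarrow> 'a" +
  fixes n :: nat and P :: "nat set" and gap :: "bool \<Rightarrow> nat" and ty :: "nat \<Rightarrow> bool"
  assumes occ: "i \<in> P \<Longrightarrow> j \<in> P \<longleftrightarrow> agree x n i j"
    and gap_pos: "0 < gap b"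
    and next_occ: "i \<in> P \<Longrightarrow> i + gap (ty i) \<in> P"
    and no_occ: "i \<in> P \<Longrightarrow> i < k \<Longrightarrow> k < i + gap (ty i) \<Longrightarrow> k \<notin> P"
    and same_loop: "i \<in> P \<Longrightarrow> j \<in> P \<Longrightarrow> ty i = ty j \<Longrightarrow> agree x (n + gap (ty i)) i j"
    and diff_loop: "i \<in> P \<Longrightarrow> j \<in> P \<Longrightarrow> ty i \<noteq> ty j \<Longrightarrow> x (i + n) \<noteq> x (j + n)"
    and diff_last: "i \<in> P \<Longrightarrow> j \<in> P \<Longrightarrow> ty i \<noteq> ty j \<Longrightarrow>
          x (i + gap (ty i) - 1) \<noteq> x (j + gap (ty j) - 1)"
    and determined: "i \<notin> P \<Longrightarrow> agree x n i j \<Longrightarrow> x (i + n) = x (j + n)"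
    and inf_loop: "\<exists>i\<ge>m. i \<in> P \<and> ty i = b"

section \<open>Construction of the two loops from a complexity increment of 1\<close>

context aperiodic_word
begin

text \<open>An increment of 1 leaves a single right special block, with two continuations. The path
  back to it depends only on the continuation, which gives two loops. Prepending their longest
  common suffix makes the block bispecial; this is the passage to a larger order.\<close>

lemma figure_eight_exists:
  assumes one: "block_complexity (Suc n) x = block_complexity n x + 1"
  shows "\<exists>N P gap ty. n \<le> N \<and> figure_eight x N P gap ty"
proof -
  obtain r r' where r: "agree x n r r'" "x (r + n) \<noteq> x (r' + n)"
    using not_eventually_deterministic by blast
  define Q where "Q = {i. agree x n r i}"
  define ty where "ty i \<longleftrightarrow> x (i + n) = x (r + n)" for i
  have occ: "j \<in> Q \<longleftrightarrow> agree x n i j" if "i \<in> Q" for i j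
    using that by (auto simp: Q_def intro: agree_trans agree_sym)
  have letter: "x (i + n) = x (j + n) \<longleftrightarrow> ty i = ty j" if "i \<in> Q" "j \<in> Q" for i j
  proof -
    have "x (i + n) = x (r' + n)" if "i \<in> Q" "\<not> ty i" for i
    proof (rule ccontr)
      assume "x (i + n) \<noteq> x (r' + n)"
      thus False using that complexity_Suc_three_letters[OF fin r(1), of i] one r(2)
        by (auto simp: Q_def ty_def)
    qed
    thus ?thesis using that by (metis ty_def)
  qed
  have det: "x (i + n) = x (j + n)" if "i \<notin> Q" "agree x n i j" for i j
    using that complexity_Suc_two_branches[OF fin r that(2)] one by (auto simp: Q_def)
  have inf: "\<exists>i\<ge>m. i \<in> Q \<and> ty i = b" for m b
  proof (rule ccontr)
    assume no: "\<not> ?thesis"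
    obtain i j where ij: "m \<le> i" "m \<le> j" "agree x n i j" "x (i + n) \<noteq> x (j + n)"
      using not_eventually_deterministic by blast
    hence "i \<in> Q" "j \<in> Q" using det occ by blast+
    thus False using no ij letter by blast
  qed
  define d where "d i = (LEAST d. 0 < d \<and> i + d \<in> Q)" for i
  have d: "0 < d i" "i + d i \<in> Q" for i
  proof -
    obtain k where "i + 1 \<le> k" "k \<in> Q" using inf by blast
    hence "0 < k - i \<and> i + (k - i) \<in> Q" by simp
    from LeastI[of "\<lambda>d. 0 < d \<and> i + d \<in> Q", OF this] show "0 < d i" "i + d i \<in> Q"
      by (auto simp: d_def)
  qed
  have dmin: "i + k \<notin> Q" if "0 < k" "k < d i" for i k
    using that not_less_Least[of k "\<lambda>d. 0 < d \<and> i + d \<in> Q"] by (auto simp: d_def)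
  have same: "agree x (n + d i) i j \<and> d j = d i" if ij: "i \<in> Q" "j \<in> Q" "ty i = ty j" for i j
  proof -
    have *: "agree x (n + k) i j" if "k \<le> d i" for k
      using that
    proof (induction k)
      case 0
      thus ?case using occ[OF ij(1), of j] ij by simp
    next
      case (Suc k)
      hence a: "agree x (k + n) i j" by (simp add: add.commute)
      have "x (i + k + n) = x (j + k + n)"
      proof (cases "k = 0")
        case False
        thus ?thesis using dmin[of k i] det[of "i + k" "j + k"] a Suc.prems by (simp add: agree_add)
      qed (use letter ij in simp)
      thus ?case using a by (simp add: agree_Suc ac_simps)
    qed
    have iff: "i + k \<in> Q \<longleftrightarrow> j + k \<in> Q" if "k \<le> d i" for k
      using *[OF that] occ by (metis add.commute agree_add agree_sym)
    have "\<not> d i < d j" using iff[of "d i"] d[of i] dmin[of "d i" j] by auto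
    moreover have "\<not> d j < d i" using iff[of "d j"] d[of j] dmin[of "d j" i] by auto
    ultimately show ?thesis using *[of "d i"] by simp
  qed
  define gap where "gap b = d (SOME i. i \<in> Q \<and> ty i = b)" for b
  have gap: "d i = gap (ty i)" if "i \<in> Q" for i
  proof -
    have "\<exists>j. j \<in> Q \<and> ty j = ty i" using that by blast
    from someI_ex[OF this] show ?thesis using same[OF that] by (simp add: gap_def)
  qed
  obtain u v where u: "u \<in> Q" "ty u" and v: "v \<in> Q" "\<not> ty v" using inf by blast
  let ?c = "gap True" and ?c' = "gap False"
  have cu: "d u = ?c" and cv: "d v = ?c'" using gap u v by auto
  text \<open>The bispecial block is the longest common suffix of the two loops.\<close>
  define K where "K k \<longleftrightarrow> 0 < k \<and> x (u + ?c - k) \<noteq> x (v + ?c' - k)" for k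
  \<comment> \<open>If one loop were a suffix of the other, the block would reappear inside the
    longer loop unless the lengths agree; in that case the loops would have the same continuation
    letter.\<close>
  have nosuf: False if ab: "a \<in> Q" "b \<in> Q" "ty a \<noteq> ty b" "d a \<le> d b"
    and eq: "\<And>k. 0 < k \<Longrightarrow> k \<le> d a \<Longrightarrow> x (a + d a - k) = x (b + d b - k)" for a b
  proof -
    let ?s = "b + d b - d a"
    have "agree x (d a) a ?s"
      unfolding agree_def
    proof (intro allI impI)
      fix k assume "k < d a"
      thus "x (a + k) = x (?s + k)" using eq[of "d a - k"] ab(4) by (simp add: ac_simps)
    qed
    moreover have "agree x n (a + d a) (?s + d a)"
      using occ[OF d(2)[of a], of "b + d b"] d(2)[of b] ab by simp
    ultimately have ag: "agree x (d a + n) a ?s" unfolding agree_add by simp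
    hence "agree x n a ?s" by (rule agree_mono) simp
    hence "?s \<in> Q" using occ[OF ab(1)] by simp
    moreover have "?s = b + (d b - d a)" using ab(4) by simp
    ultimately have "b + (d b - d a) \<in> Q" by simp
    moreover have "d b - d a < d b" using d(1)[of a] d(1)[of b] by simp
    ultimately have "\<not> 0 < d b - d a" using dmin by blast
    hence "d b = d a" using ab(4) by simp
    hence "x (a + n) = x (b + n)" using agreeD[OF ag, of n] d[of a] by simp
    thus False using letter ab by blast
  qed
  have "\<exists>k. K k \<and> k \<le> ?c \<and> k \<le> ?c'"
  proof (rule ccontr)
    assume no: "\<not> ?thesis"
    have eq: "x (u + ?c - k) = x (v + ?c' - k)" if "0 < k" "k \<le> ?c" "k \<le> ?c'" for k
      using no that unfolding K_def by blast
    show False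
    proof (cases "?c \<le> ?c'")
      case True
      show False by (rule nosuf[of u v]) (use u v cu cv eq True in simp_all)
    next
      case False
      show False by (rule nosuf[of v u]) (use u v cu cv eq[symmetric] False in simp_all)
    qed
  qed
  then obtain k1 where k1: "K k1" "k1 \<le> ?c" "k1 \<le> ?c'" by blast
  define k0 where "k0 = (LEAST k. K k)"
  have k0: "K k0" "k0 \<le> ?c" "k0 \<le> ?c'"
    using LeastI[of K, OF k1(1)] Least_le[of K, OF k1(1)] k1 by (auto simp: k0_def)
  have k0min: "x (u + ?c - k) = x (v + ?c' - k)" if "0 < k" "k < k0" for k
    using that not_less_Least[of k K] by (auto simp: k0_def K_def)
  have "0 < k0" using k0 by (simp add: K_def)
  define m where "m = k0 - 1"
  have m: "k0 = Suc m" "m < ?c" "m < ?c'" using \<open>0 < k0\<close> k0 by (auto simp: m_def)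
  \<comment> \<open>The bispecial block is the common suffix, of length \<open>m\<close>, followed
    by the block whose occurrences form \<open>Q\<close>.\<close>
  define w where "w = u + ?c - m"
  define P where "P = {i. agree x (m + n) w i}"
  have wv: "agree x (m + n) w (v + ?c' - m)"
  proof -
    have "agree x m w (v + ?c' - m)"
      unfolding agree_def w_def
    proof (intro allI impI)
      fix k assume "k < m"
      thus "x (u + ?c - m + k) = x (v + ?c' - m + k)" using k0min[of "m - k"] m by (simp add: ac_simps)
    qed
    moreover have "agree x n (w + m) (v + ?c' - m + m)"
      using occ[OF d(2)[of u], of "v + d v"] d(2)[of v] cu cv m by (simp add: w_def)
    ultimately show ?thesis unfolding agree_add by simp
  qed
  have PQ: "i + m \<in> Q" if "i \<in> P" for i
  proof -
    have "agree x n (w + m) (i + m)" using that by (simp add: P_def agree_add)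
    moreover have "w + m \<in> Q" using d[of u] cu m by (simp add: w_def)
    ultimately show ?thesis using occ by blast
  qed
  have QP: "j + gap (ty j) - m \<in> P" if j: "j \<in> Q" for j
  proof -
    obtain a where a: "a \<in> Q" "ty a = ty j" "agree x (m + n) w (a + gap (ty j) - m)"
    proof (cases "ty j")
      case True
      thus ?thesis using that[of u] u by (simp add: w_def)
    next
      case False
      thus ?thesis using that[of v] v wv by simp
    qed
    have g: "gap (ty j) - m + (m + n) = n + gap (ty j)" using m by (cases "ty j") auto
    have "agree x (n + gap (ty j)) a j" using same[OF a(1) j a(2)] gap[OF a(1)] a(2) by simp
    hence "agree x (m + n) (a + (gap (ty j) - m)) (j + (gap (ty j) - m))"
      unfolding g[symmetric] agree_add[of x "gap (ty j) - m"] by simp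
    hence "agree x (m + n) (a + gap (ty j) - m) (j + gap (ty j) - m)"
      using m by (cases "ty j") auto
    thus ?thesis using a(3) unfolding P_def by (blast intro: agree_trans)
  qed
  \<comment> \<open>By \<open>QP\<close>, an occurrence that ends a loop is preceded by the common
    suffix. Only the very first element of \<open>Q\<close> can fail this.\<close>
  have first: "i + m - k \<notin> Q" if i: "i \<notin> P" "i + m \<in> Q" and k: "0 < k" "k \<le> i + m" for i k
  proof
    assume "i + m - k \<in> Q"
    define S where "S = {j \<in> Q. j < i + m}"
    have S: "finite S" "S \<noteq> {}" using \<open>i + m - k \<in> Q\<close> k by (auto simp: S_def intro: finite_subset)
    define j where "j = Max S"
    have j: "j \<in> Q" "j < i + m" using Max_in[OF S] by (auto simp: j_def S_def)
    have "j + d j \<notin> S"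
      using Max_ge[OF S(1), of "j + d j"] d(1)[of j] unfolding j_def[symmetric] by auto
    hence "\<not> j + d j < i + m" using d(2)[of j] by (simp add: S_def)
    moreover have "\<not> i + m < j + d j"
    proof
      assume "i + m < j + d j"
      hence "0 < i + m - j" "i + m - j < d j" using j(2) by linarith+
      from dmin[OF this] show False using i(2) j(2) by simp
    qed
    ultimately have "i + m = j + d j" by simp
    hence "i = j + gap (ty j) - m" using gap[OF j(1)] by simp
    thus False using QP[OF j(1)] i by simp
  qed
  define tyP where "tyP i = ty (i + m)" for i
  have occP: "j \<in> P \<longleftrightarrow> agree x (m + n) i j" if "i \<in> P" for i j
    using that by (auto simp: P_def intro: agree_trans agree_sym)
  have "figure_eight x (m + n) P gap tyP"
  proof unfold_locales
    show "i \<in> P \<Longrightarrow> j \<in> P \<longleftrightarrow> agree x (m + n) i j" for i j by (rule occP)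
    show "0 < gap b" for b using d(1) by (simp add: gap_def)
    show "i + gap (tyP i) \<in> P" if "i \<in> P" for i
      using QP[OF PQ[OF that]] by (simp add: tyP_def add.commute add.left_commute)
    show "k \<notin> P" if "i \<in> P" "i < k" "k < i + gap (tyP i)" for i k
      using PQ[of k] dmin[of "k - i" "i + m"] gap[OF PQ[OF that(1)]] that
      by (auto simp: tyP_def ac_simps)
    show "agree x (m + n + gap (tyP i)) i j" if "i \<in> P" "j \<in> P" "tyP i = tyP j" for i j
    proof -
      have "agree x (n + gap (tyP i)) (i + m) (j + m)"
        using same[of "i + m" "j + m"] PQ that gap[of "i + m"] by (simp add: tyP_def)
      moreover have "agree x m i j" using occP that agree_mono by (metis le_add1)
      ultimately show ?thesis by (simp add: agree_add add.assoc)
    qed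
    show "x (i + (m + n)) \<noteq> x (j + (m + n))" if "i \<in> P" "j \<in> P" "tyP i \<noteq> tyP j" for i j
      using letter[of "i + m" "j + m"] PQ that by (simp add: tyP_def add.assoc)
    show "x (i + (m + n)) = x (j + (m + n))" if "i \<notin> P" "agree x (m + n) i j" for i j
    proof (cases "i + m \<in> Q")
      case True
      hence jQ: "j + m \<in> Q" using that occ[OF True] by (simp add: agree_add)
      have "j \<notin> P" using that occP agree_sym by blast
      \<comment> \<open>Both \<open>i + m\<close> and \<open>j + m\<close> are the first element of
        \<open>Q\<close>, so the two positions coincide.\<close>
      have le: "a \<le> b" if "a \<notin> P" "a + m \<in> Q" "b + m \<in> Q" for a b
      proof (rule ccontr)
        assume "\<not> a \<le> b"
        hence "0 < a - b" "a - b \<le> a + m" "a + m - (a - b) = b + m" by auto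
        thus False using first[OF that(1,2)] that(3) by metis
      qed
      have "i = j" using le[OF that(1) True jQ] le[OF \<open>j \<notin> P\<close> jQ True] by simp
      thus ?thesis by simp
    next
      case False
      thus ?thesis using det[of "i + m" "j + m"] that by (simp add: agree_add add.assoc)
    qed
    show "\<exists>i\<ge>l. i \<in> P \<and> tyP i = b" for l b
    proof -
      obtain j where j: "l + m \<le> j" "j \<in> Q" using inf by blast
      obtain i where i: "j + gap (ty j) \<le> i" "i \<in> Q" "ty i = b" using inf by blast
      have "i - m \<in> P"
      proof (rule ccontr)
        assume "i - m \<notin> P"
        thus False using first[of "i - m" "i - j"] i j d(1)[of j] gap[OF j(2)] by simp
      qed
      thus ?thesis using i j by (intro exI[of _ "i - m"]) (simp add: tyP_def)
    qed
    \<comment> \<open>The new loops start \<open>m\<close> letters earlier, so their last letters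
      are those at distance \<open>k0\<close> from the end of the old loops, where the two
      differ.\<close>
    have last: "x (i + gap (tyP i) - 1) = x (a + gap (tyP i) - k0)"
      if i: "i \<in> P" and a: "a \<in> Q" "ty a = tyP i" for i a
    proof -
      have g: "k0 \<le> gap (tyP i)" using k0 by (cases "tyP i") auto
      have "agree x (n + gap (tyP i)) (i + m) a"
        using same[of "i + m" a] PQ[OF i] a gap[of "i + m"] by (simp add: tyP_def)
      hence "x (i + m + (gap (tyP i) - k0)) = x (a + (gap (tyP i) - k0))"
        by (rule agreeD) (use g \<open>0 < k0\<close> in simp)
      thus ?thesis using g m(1) by simp
    qed
    show "x (i + gap (tyP i) - 1) \<noteq> x (j + gap (tyP j) - 1)"
      if "i \<in> P" "j \<in> P" "tyP i \<noteq> tyP j" for i j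
      using that last[of _ u] last[of _ v] u v k0(1) unfolding K_def
      by (cases "tyP i"; cases "tyP j") (metis (full_types))+
  qed
  thus ?thesis by (metis le_add2)
qed

lemma transient_complexity:
  assumes "\<And>u v. u < t \<Longrightarrow> u < v \<Longrightarrow> \<not> agree x n u v"
  shows "t + block_complexity n (\<lambda>k. x (t + k)) \<le> block_complexity n x"
proof -
  define w where "w i = map x [i..<i + n]" for i
  have w: "w i = w j \<longleftrightarrow> agree x n i j" for i j by (simp add: w_def map_upt_eq_iff)
  have B: "blocks n x = range w" by (auto simp: blocks_def w_def)
  have "map (\<lambda>k. x (t + k)) [j..<j + n] = w (t + j)" for j
    by (simp add: w_def list_eq_iff_nth_eq add.assoc)
  hence B': "blocks n (\<lambda>k. x (t + k)) = w ` {t..}"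
    unfolding blocks_def by (auto simp: image_iff) (metis le_iff_add)
  have "inj_on w {..<t}"
    using assms w by (intro inj_onI) (metis lessThan_iff linorder_neqE_nat)
  moreover have "w ` {..<t} \<inter> w ` {t..} = {}"
    using assms w by (auto simp: disjoint_iff)
  moreover have "finite (w ` {t..})" using finite_blocks[OF fin] B by (metis finite_subset image_mono subset_UNIV)
  ultimately have "card (w ` {..<t} \<union> w ` {t..}) = t + card (w ` {t..})"
    by (simp add: card_Un_disjoint card_image)
  moreover have "{..<t} \<union> {t..} = UNIV" by auto
  hence "w ` {..<t} \<union> w ` {t..} = range w" by (metis image_Un)
  ultimately show ?thesis by (simp add: block_complexity_def B B')
qed

end

section \<open>Runs of loops, the transient part and lower bounds for the complexity\<close>

context figure_eight
begin

text \<open>Only positions in \<open>P\<close> leave a choice of the next letter, so an agreement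
  propagates until \<open>P\<close> is met.\<close>

lemma agree_determined:
  assumes "agree x n i j" and "\<And>k. k < m \<Longrightarrow> i + k \<notin> P"
  shows "agree x (m + n) i j"
  using assms(2)
proof (induction m)
  case (Suc m)
  hence "agree x (m + n) i j" by simp
  moreover from this have "x (i + m + n) = x (j + m + n)"
    using determined[of "i + m" "j + m"] Suc.prems by (simp add: agree_add)
  ultimately show ?case by (simp add: agree_Suc add.assoc)
qed (use assms(1) in simp)

lemma occ_agree: "i \<in> P \<Longrightarrow> j \<in> P \<Longrightarrow> agree x n i j"
  using occ by blast

lemma ex_prev_occ:
  assumes "i \<in> P" "u \<in> P" "u < i"
  shows "\<exists>j\<in>P. u \<le> j \<and> i = j + gap (ty j)"
proof -
  define S where "S = {j \<in> P. j < i}"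
  have S: "finite S" "u \<in> S" using assms by (auto simp: S_def)
  define j where "j = Max S"
  have "j \<in> S" unfolding j_def by (rule Max_in) (use S in auto)
  hence j: "j \<in> P" "j < i" by (auto simp: S_def)
  have "u \<le> j" using S Max_ge by (simp add: j_def)
  have "\<not> i < j + gap (ty j)" using no_occ j assms(1) by blast
  moreover have "j + gap (ty j) \<notin> S"
    using Max_ge[OF S(1), of "j + gap (ty j)"] gap_pos[of "ty j"] unfolding j_def[symmetric] by auto
  hence "\<not> j + gap (ty j) < i" using next_occ[OF j(1)] by (simp add: S_def)
  ultimately show ?thesis using j \<open>u \<le> j\<close> by (intro bexI[of _ j]) auto
qed

lemma run_occ:
  assumes "i \<in> P" "\<And>a. a < k \<Longrightarrow> ty (i + a * gap b) = b" "a \<le> k"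
  shows "i + a * gap b \<in> P"
  using assms(3)
proof (induction a)
  case (Suc a)
  thus ?case using next_occ[of "i + a * gap b"] assms(2)[of a] by (simp add: ac_simps)
qed (use assms in simp)

lemma run_agree:
  assumes "i \<in> P" "\<And>a. a < k \<Longrightarrow> ty (i + a * gap b) = b"
    and "j \<in> P" "\<And>a. a < k \<Longrightarrow> ty (j + a * gap b) = b"
  shows "agree x (k * gap b + n) i j"
  using assms(2,4)
proof (induction k)
  case (Suc k)
  have "i + k * gap b \<in> P" "j + k * gap b \<in> P"
    using run_occ[OF assms(1), of "Suc k" b k] run_occ[OF assms(3), of "Suc k" b k] Suc.prems by auto
  hence "agree x (n + gap b) (i + k * gap b) (j + k * gap b)"
    using same_loop[of "i + k * gap b" "j + k * gap b"] Suc.prems(1)[of k] Suc.prems(2)[of k] by simp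
  moreover have "agree x (k * gap b) i j" using Suc by (auto intro: agree_mono)
  ultimately have "agree x (k * gap b + (n + gap b)) i j" by (simp add: agree_add)
  thus ?case by (simp add: ac_simps)
qed (use occ_agree assms in simp)

lemma ex_run:
  assumes i: "i \<in> P"
  obtains k where "\<And>a. a < k \<Longrightarrow> ty (i + a * gap b) = b" "i + k * gap b \<in> P"
    "ty (i + k * gap b) \<noteq> b"
proof -
  have "\<exists>k. ty (i + k * gap b) \<noteq> b"
  proof (rule ccontr)
    assume "\<not> ?thesis"
    hence all: "ty (i + a * gap b) = b" for a by blast
    hence P: "i + a * gap b \<in> P" for a using run_occ[OF i, of a b a] by simp
    obtain j where j: "i \<le> j" "j \<in> P" "ty j \<noteq> b" using inf_loop by (metis (full_types))
    define q where "q = (j - i) div gap b"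
    have q: "q * gap b \<le> j - i" "j - i < q * gap b + gap b"
      using div_mult_mod_eq[of "j - i" "gap b"] mod_less_divisor[OF gap_pos[of b], of "j - i"]
      unfolding q_def by linarith+
    have "j \<noteq> i + q * gap b" using all j by metis
    hence "i + q * gap b < j" "j < i + q * gap b + gap b" using q j(1) by auto
    thus False using no_occ[OF P, of q j] all[of q] j by simp
  qed
  then obtain k where "ty (i + k * gap b) \<noteq> b" "\<And>a. a < k \<Longrightarrow> ty (i + a * gap b) = b"
    using exists_least_iff[of "\<lambda>k. ty (i + k * gap b) \<noteq> b"] by blast
  thus ?thesis using that run_occ[OF i, of k b k] by blast
qed

text \<open>
  The prefix before the first occurrence \<open>tau\<close> agrees, read backwards, with \<open>lam b\<close> letters of the
  loop \<open>b\<close>; what remains is the \<open>transient\<close> part.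
\<close>

definition tau :: nat where "tau = (LEAST i. i \<in> P)"

lemma tau: "tau \<in> P" "i \<in> P \<Longrightarrow> tau \<le> i"
  using inf_loop[of 0 True] unfolding tau_def by (auto intro: LeastI Least_le)

definition left_match :: "bool \<Rightarrow> nat \<Rightarrow> bool" where
  "left_match b l \<longleftrightarrow> l < gap b \<and> l \<le> tau \<and>
     (\<forall>s\<in>P. ty s = b \<longrightarrow> agree x l (tau - l) (s + gap b - l))"

definition lam :: "bool \<Rightarrow> nat" where "lam b = (GREATEST l. left_match b l)"

lemma left_match_lam: "left_match b (lam b)"
  and left_match_le: "left_match b l \<Longrightarrow> l \<le> lam b"
proof -
  have 0: "left_match b 0" using gap_pos by (simp add: left_match_def agree_def)
  have bd: "\<And>l. left_match b l \<Longrightarrow> l \<le> gap b" by (simp add: left_match_def)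
  show "left_match b (lam b)"
    unfolding lam_def by (rule GreatestI_nat[of "left_match b", OF 0 bd])
  show "left_match b l \<Longrightarrow> l \<le> lam b"
    unfolding lam_def by (rule Greatest_le_nat[of "left_match b", OF _ bd])
qed

lemma lam: "lam b < gap b" "lam b \<le> tau"
  using left_match_lam by (auto simp: left_match_def)

text \<open>Extending a match with \<open>tau\<close> to the left lengthens the repetition and moves
  it to an earlier position; both improve the resulting approximation.\<close>

lemma agree_lam:
  assumes "s \<in> P" "agree x m tau (s + gap (ty s))"
  shows "agree x (lam (ty s) + m) (tau - lam (ty s)) (s + gap (ty s) - lam (ty s))"
  using left_match_lam[of "ty s"] assms lam[of "ty s"]
  by (auto simp: left_match_def agree_add)

text \<open>All loops of one type spell the same word, so a single witness suffices.\<close>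

lemma left_matchI:
  assumes "s \<in> P" "l < gap (ty s)" "l \<le> tau" "agree x l (tau - l) (s + gap (ty s) - l)"
  shows "left_match (ty s) l"
  unfolding left_match_def
proof (intro conjI ballI impI)
  fix s' assume s': "s' \<in> P" "ty s' = ty s"
  let ?g = "gap (ty s)"
  have "agree x (?g + n) s s'" using same_loop[of s s'] assms(1) s' by (simp add: add.commute)
  hence "agree x ?g s s'" by (rule agree_mono) simp
  hence "agree x ((?g - l) + l) s s'" using assms(2) by simp
  hence "agree x l (s + ?g - l) (s' + ?g - l)" unfolding agree_add using assms(2) by simp
  thus "agree x l (tau - l) (s' + gap (ty s) - l)" using assms(4) agree_trans by blast
qed (use assms in auto)

text \<open>The loops end in different letters, and the letter before \<open>tau\<close> can match
  only one of them.\<close>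

lemma lam_zero: "b \<noteq> b' \<Longrightarrow> lam b = 0 \<or> lam b' = 0"
proof (rule ccontr)
  assume b: "b \<noteq> b'" and no: "\<not> ?thesis"
  obtain s s' where s: "s \<in> P" "ty s = b" "s' \<in> P" "ty s' = b'" using inf_loop by metis
  have *: "x (tau - 1) = x (s + gap b - 1)" if "lam b \<noteq> 0" "s \<in> P" "ty s = b" for b s
  proof -
    have "agree x (lam b) (tau - lam b) (s + gap b - lam b)"
      using left_match_lam that by (auto simp: left_match_def)
    from agreeD[OF this, of "lam b - 1"] show ?thesis using lam[of b] that(1) by simp
  qed
  have "x (s + gap b - 1) = x (s' + gap b' - 1)" using *[of b s] *[of b' s'] no s by simp
  thus False using diff_last[of s s'] s b by simp
qed

definition transient :: nat where "transient = tau - lam True - lam False"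

lemma tau_eq: "tau = transient + lam True + lam False"
  using lam_zero[of True False] lam(2)[of True] lam(2)[of False] by (auto simp: transient_def)

text \<open>Two copies would run in parallel until the first reaches \<open>tau\<close> and the
  second an occurrence after \<open>tau\<close>. The latter ends a loop that contains
  \<open>v\<close> in its interior, so the \<open>tau - u\<close> letters before \<open>tau\<close>
  match a suffix of this loop and \<open>tau - u\<close> is at most its \<open>lam\<close>.\<close>

lemma transient_not_recurrent:
  assumes "u < transient" "u < v"
  shows "\<not> agree x n u v"
proof
  assume ag: "agree x n u v"
  let ?m = "tau - u"
  have u: "u < tau" using assms tau_eq by simp
  have uP: "u + k \<notin> P" if "k < ?m" for k
    using tau(2)[of "u + k"] that by auto
  have ag': "agree x (?m + n) u v" by (rule agree_determined[OF ag uP])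
  hence "agree x n (u + ?m) (v + ?m)" unfolding agree_add by blast
  hence "agree x n tau (v + ?m)" using u by simp
  hence w: "v + ?m \<in> P" using occ[OF tau(1)] by simp
  moreover have "tau < v + ?m" using u assms by simp
  ultimately obtain j where j: "j \<in> P" "v + ?m = j + gap (ty j)"
    using ex_prev_occ[OF w tau(1)] by auto
  have "j < v"
  proof (rule ccontr)
    assume "\<not> j < v"
    then obtain k where k: "j = v + k" using le_Suc_ex not_less by blast
    have "k < ?m" using j(2) gap_pos[of "ty j"] k by simp
    have "agree x (k + n) u v" using ag' by (rule agree_mono) (use \<open>k < ?m\<close> in simp)
    hence "agree x n (u + k) j" using k by (simp add: agree_add)
    hence "u + k \<in> P" using occ[OF j(1)] agree_sym by blast
    thus False using uP \<open>k < ?m\<close> by blast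
  qed
  hence m: "?m < gap (ty j)" "j + gap (ty j) - ?m = v" using j(2) by auto
  have "left_match (ty j) ?m"
    using ag' m u by (intro left_matchI[OF j(1)]) (auto intro: agree_mono)
  hence "?m \<le> lam (ty j)" by (rule left_match_le)
  hence "?m \<le> lam True + lam False" by (cases "ty j") auto
  thus False using assms tau_eq u by simp
qed

text \<open>The block at a loop position fixes the letters up to the next occurrence, hence the
  distance to it; the last of these letters then tells the loop. The start is common to both loops,
  which is the second alternative.\<close>

lemma loop_positions:
  assumes s: "s \<in> P" "0 < r" "r \<le> gap (ty s)" and s': "s' \<in> P" "0 < r'" "r' \<le> gap (ty s')"
    and ag: "agree x n (s + gap (ty s) - r) (s' + gap (ty s') - r')" and le: "r \<le> r'"
  shows "r = r' \<and> ty s = ty s' \<or> r = gap (ty s) \<and> r' = gap (ty s')"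
proof (cases "r = gap (ty s)")
  case True
  hence "s' + gap (ty s') - r' \<in> P" using ag s(1) occ[OF s(1)] by simp
  hence "r' = gap (ty s')" using no_occ[OF s'(1), of "s' + gap (ty s') - r'"] s' by force
  thus ?thesis using True by simp
next
  case False
  let ?p = "s + gap (ty s) - r" and ?p' = "s' + gap (ty s') - r'"
  have "?p + k \<notin> P" if "k < r" for k
    using no_occ[OF s(1), of "?p + k"] that False s by simp
  hence ag': "agree x (r + n) ?p ?p'" by (rule agree_determined[OF ag])
  hence "agree x n (s + gap (ty s)) (?p' + r)" using s by (simp add: agree_add)
  hence P: "?p' + r \<in> P" using occ[OF next_occ[OF s(1)]] by simp
  have "r = r'"
  proof (rule ccontr)
    assume "r \<noteq> r'"
    thus False using no_occ[OF s'(1), of "?p' + r"] P s' s le by simp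
  qed
  moreover have "ty s = ty s'"
  proof (rule ccontr)
    assume ne: "ty s \<noteq> ty s'"
    have "x (?p + (r - 1)) = x (?p' + (r - 1))" by (rule agreeD[OF ag']) (use s in simp)
    thus False using diff_last[OF s(1) s'(1) ne] s s' \<open>r = r'\<close> by simp
  qed
  ultimately show ?thesis by simp
qed

text \<open>This counts vertices of the graph; the \<open>1\<close> on the right accounts for the
  bispecial block, which lies on both loops.\<close>

lemma complexity_ge_loops: "transient + gap True + gap False \<le> block_complexity n x + 1"
proof -
  obtain u v where u: "u \<in> P" "ty u" and v: "v \<in> P" "\<not> ty v" using inf_loop by (metis (full_types))
  \<comment> \<open>\<open>A\<close> contains the start of its loop and \<open>B\<close> does not,
    so the common block is counted once.\<close>
  define A where "A = {u..<u + gap True}"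
  define B where "B = {v<..<v + gap False}"
  have disj: "A \<inter> B = {}"
  proof (rule ccontr)
    assume "\<not> ?thesis"
    then obtain p where p: "u \<le> p" "p < u + gap True" "v < p" "p < v + gap False"
      by (auto simp: A_def B_def)
    have "u \<noteq> v" using u v by auto
    thus False using no_occ[OF u(1), of v] no_occ[OF v(1), of u] u v p by fastforce
  qed
  have ex: "\<exists>s r. s \<in> {u, v} \<and> p = s + gap (ty s) - r \<and> 0 < r \<and> r \<le> gap (ty s) \<and> (s = v \<longrightarrow> r < gap (ty s))"
    if "p \<in> A \<union> B" for p
    using that
  proof
    assume "p \<in> A"
    thus ?thesis using u v by (intro exI[of _ u] exI[of _ "u + gap True - p"]) (auto simp: A_def)
  next
    assume "p \<in> B"
    thus ?thesis using u v by (intro exI[of _ v] exI[of _ "v + gap False - p"]) (auto simp: B_def)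
  qed
  have eq: "p = q" if pq: "p \<in> A \<union> B" "q \<in> A \<union> B" "agree x n p q" for p q
  proof -
    obtain s r where s: "s \<in> {u, v}" "p = s + gap (ty s) - r" "0 < r" "r \<le> gap (ty s)"
      "s = v \<longrightarrow> r < gap (ty s)" using ex[OF pq(1)] by blast
    obtain s' r' where s': "s' \<in> {u, v}" "q = s' + gap (ty s') - r'" "0 < r'" "r' \<le> gap (ty s')"
      "s' = v \<longrightarrow> r' < gap (ty s')" using ex[OF pq(2)] by blast
    have P: "s \<in> P" "s' \<in> P" using s s' u v by auto
    have "r = r' \<and> ty s = ty s' \<or> r = gap (ty s) \<and> r' = gap (ty s')"
    proof (cases "r \<le> r'")
      case True
      thus ?thesis using loop_positions[OF P(1) s(3,4) P(2) s'(3,4)] pq(3) s(2) s'(2) by simp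
    next
      case False
      thus ?thesis using loop_positions[OF P(2) s'(3,4) P(1) s(3,4)] agree_sym[OF pq(3)] s(2) s'(2)
        by auto
    qed
    thus ?thesis
    proof (elim disjE conjE)
      assume "r = r'" "ty s = ty s'"
      moreover have "s = s'" using s(1) s'(1) u v calculation(2) by auto
      ultimately show ?thesis using s s' by simp
    next
      assume "r = gap (ty s)" "r' = gap (ty s')"
      moreover have "s = u" "s' = u" using calculation s s' by auto
      ultimately show ?thesis using s s' by simp
    qed
  qed
  have ge: "transient \<le> p" if "p \<in> A \<union> B" for p
    using that tau(2)[OF u(1)] tau(2)[OF v(1)] tau_eq by (auto simp: A_def B_def)
  let ?y = "\<lambda>k. x (transient + k)"
  have "card ((\<lambda>p. p - transient) ` (A \<union> B)) \<le> block_complexity n ?y"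
  proof (rule card_le_complexity)
    show "finite (range ?y)" by (rule finite_subset[OF _ fin]) auto
    fix i j assume "i \<in> (\<lambda>p. p - transient) ` (A \<union> B)" "j \<in> (\<lambda>p. p - transient) ` (A \<union> B)"
      and ag: "agree ?y n i j"
    then obtain p q where pq: "p \<in> A \<union> B" "i = p - transient" "q \<in> A \<union> B" "j = q - transient" by blast
    hence "agree x n p q" using ag ge by (simp add: agree_shift)
    thus "i = j" using eq pq by blast
  qed
  moreover have "card ((\<lambda>p. p - transient) ` (A \<union> B)) = card (A \<union> B)"
    by (rule card_image) (use ge in \<open>auto intro!: inj_onI simp: eq_diff_iff\<close>)
  moreover have "card (A \<union> B) = gap True + (gap False - 1)"
    using disj by (subst card_Un_disjoint) (auto simp: A_def B_def)
  ultimately show ?thesis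
    using transient_complexity[of transient n] transient_not_recurrent gap_pos[of False] by fastforce
qed

text \<open>The tail after the transient part is still aperiodic and contributes at least
  \<open>n + 1\<close> blocks.\<close>

lemma complexity_ge_transient: "transient + n + 1 \<le> block_complexity n x"
  using transient_complexity[of transient n] transient_not_recurrent
    aperiodic_word.complexity_ge[OF aperiodic_shift, of n transient] by fastforce

end

section \<open>Linear inequalities\<close>

text \<open>
  These bounds replace the products \<open>s * j\<close> by linear expressions, with \<open>s * n\<close> as a new variable;
  the constants \<open>J\<close> used below were found with an LP solver.
\<close>

lemma product_bounds:
  fixes s j n J \<sigma> :: real
  assumes "0 \<le> s" "s \<le> \<sigma>" "0 \<le> j"
  shows "s * j \<le> \<sigma> * j" "J * n < j \<or> s * j \<le> J * (s * n)"
  using assms mult_left_mono[of j "J * n" s] mult_right_mono[of s \<sigma> j] by (force simp: mult.left_commute)+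

text \<open>Here \<open>t\<close> is the transient length, \<open>l\<close>, \<open>l'\<close> are
  the left matches and \<open>c\<close>, \<open>c'\<close> the loop lengths; \<open>y\<close> is the
  first run of the second loop without one turn, \<open>z\<close> the part of it that recurs in the
  second run, and \<open>e\<close> the number of lengths at which two right special blocks coexist.
  Facts 1 to 4 come from repetitions, fact 5 from the complexity.\<close>

lemma arith_alternating:
  fixes n t l l' c c' y z e s r :: real
  assumes n: "1000 \<le> n" and s: "0 \<le> s" "0 \<le> r" "s + 3/5 * r \<le> 21/100" "r \<le> 1/3"
    and nn: "0 \<le> t" "0 \<le> l" "0 \<le> l'" "0 \<le> y" "0 \<le> z" and ll: "l = 0 \<or> l' = 0"
    and lc: "l \<le> c" "l' \<le> c'" and t: "t \<le> r * n" and P: "t + c + c' \<le> (1 + r) * n + 1"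
    and 1: "n + l \<le> (1 + s) * (t + l + l' + c - l)"
    and 2: "n + y \<le> (1 + s) * (t + l + l' + c + c')"
    and 3: "n + l' \<le> (1 + s) * (t + l + l' + c + c' - l')"
    and 4: "n + l' + c + z \<le> (1 + s) * (t + l + l' + c + c' + y - l')"
    and 5: "z = y \<or> z \<le> y - c' \<and> e = min c (y - z)
              \<and> t + c + c' + z + 2 * e \<le> (1 + r) * (n + z + e + 1)"
  shows False
proof -
  define j1 j2 j3 j4 j5 where j: "j1 = t + l + l' + c - l" "j2 = t + l + l' + c + c'"
    "j3 = t + l + l' + c + c' - l'" "j4 = t + l + l' + c + c' + y - l'" "j5 = n + z + e + 1"
  have s21: "s \<le> 21/100" using s by linarith
  have j0: "0 \<le> j1" "0 \<le> j2" "0 \<le> j3" "0 \<le> j4" using nn lc by (auto simp: j)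
  \<comment> \<open>After scaling by \<open>n\<close>, the products \<open>s * n\<close> and
    \<open>r * n\<close> act as variables of a linear system.\<close>
  have R: "s * n + 3/5 * (r * n) \<le> 21/100 * n" "r * n \<le> 1/3 * n" "0 \<le> s * n" "0 \<le> r * n"
    using mult_right_mono[OF s(3), of n] mult_right_mono[OF s(4), of n] n s(1,2)
    by (auto simp: algebra_simps)
  note B = product_bounds[OF s(1) s21]
  note b = B(1)[OF j0(1)] B(1)[OF j0(2)] B(1)[OF j0(3)] B(1)[OF j0(4)]
  note d1 = B(2)[OF j0(1), of "67/50" n] and d2 = B(2)[OF j0(2), of 2 n]
    and d3 = B(2)[OF j0(3), of 2 n] and d4 = B(2)[OF j0(4), of "13/5" n]
  have I: "n + l \<le> j1 + s * j1" "n + y \<le> j2 + s * j2" "n + l' \<le> j3 + s * j3" 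
      "n + l' + c + z \<le> j4 + s * j4" "t + c + c' \<le> n + r * n + 1"
    using 1 2 3 4 P by (simp_all add: j algebra_simps)
  note facts = n nn lc t j(1-4) R b I
  from 5 show False
  proof (elim disjE conjE)
    assume zy: "z = y"
    show False using facts zy ll d1 d2 d4 by argo
  next
    assume a: "z \<le> y - c'" "e = min c (y - z)" "t + c + c' + z + 2 * e \<le> (1 + r) * (n + z + e + 1)"
    have e0: "0 \<le> j5" using a lc nn n by (auto simp: j)
    note d5 = product_bounds(2)[OF s(2,4) e0, of "9/5" n]
      and b5 = product_bounds(1)[OF s(2,4) e0]
    have I5: "t + c + c' + z + 2 * e \<le> j5 + r * j5" using a by (simp add: j algebra_simps)
    consider "e = c" "c \<le> y - z" | "e = y - z" "y - z \<le> c" using a(2) by linarith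
    thus False
    proof cases
      case 1
      show False using facts a(1) 1 j(5) b5 I5 ll d2 d3 d5 by argo
    next
      case 2
      show False using facts a(1) 2 j(5) b5 I5 ll d1 d2 d4 d5 by argo
    qed
  qed
qed

text \<open>The variables are as before, except that \<open>y\<close> is the first run of the first
  loop without one turn. Fact 3 separates the cases that the second loop is followed by the first
  one, which gives a longer repetition, or by itself.\<close>

lemma arith_repeating:
  fixes n t l l' c c' y e s r :: real
  assumes n: "1000 \<le> n" and s: "0 \<le> s" "0 \<le> r" "s + 3/5 * r \<le> 21/100" "r \<le> 1/3"
    and nn: "0 \<le> t" "0 \<le> l" "0 \<le> l'" and ll: "l = 0 \<or> l' = 0"
    and lc: "l \<le> c" "l' \<le> c'" "c \<le> y" and t: "t \<le> r * n" and P: "t + c + c' \<le> (1 + r) * n + 1"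
    and 1: "n + y + l \<le> (1 + s) * (t + l + l' + c - l)"
    and 2: "n + l' \<le> (1 + s) * (t + l + l' + y + c + c' - l')"
    and 3: "n + l' + c \<le> (1 + s) * (t + l + l' + y + c + c' - l') \<or>
            e = min c' y \<and> t + c + c' + 2 * e \<le> (1 + r) * (n + e + 1)"
  shows False
proof -
  define j1 j2 j5 where j: "j1 = t + l + l' + c - l" "j2 = t + l + l' + y + c + c' - l'" "j5 = n + e + 1"
  have s21: "s \<le> 21/100" using s by linarith
  have j0: "0 \<le> j1" "0 \<le> j2" using nn lc by (auto simp: j)
  have R: "s * n + 3/5 * (r * n) \<le> 21/100 * n" "r * n \<le> 1/3 * n" "0 \<le> s * n" "0 \<le> r * n"
    using mult_right_mono[OF s(3), of n] mult_right_mono[OF s(4), of n] n s(1,2)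
    by (auto simp: algebra_simps)
  note B = product_bounds[OF s(1) s21]
  note b = B(1)[OF j0(1)] B(1)[OF j0(2)]
  note d1 = B(2)[OF j0(1), of "2" n] and d2 = B(2)[OF j0(2), of "2" n]
  have I: "n + y + l \<le> j1 + s * j1" "n + l' \<le> j2 + s * j2" "t + c + c' \<le> n + r * n + 1"
    using 1 2 P by (simp_all add: j algebra_simps)
  note facts = n nn lc t j(1-2) R b I
  from 3 show False
  proof (elim disjE conjE)
    assume "n + l' + c \<le> (1 + s) * (t + l + l' + y + c + c' - l')"
    hence "n + l' + c \<le> j2 + s * j2" by (simp add: j algebra_simps)
    thus False using facts ll d2 d1 by argo
  next
    assume a: "e = min c' y" "t + c + c' + 2 * e \<le> (1 + r) * (n + e + 1)"
    have e0: "0 \<le> j5" using a lc nn n by (auto simp: j)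
    note d5 = product_bounds(2)[OF s(2,4) e0, of "9/5" n]
      and b5 = product_bounds(1)[OF s(2,4) e0]
    have I5: "t + c + c' + 2 * e \<le> j5 + r * j5" using a by (simp add: j algebra_simps)
    consider "e = c'" "c' \<le> y" | "e = y" "y \<le> c'" using a(1) by linarith
    thus False
    proof cases
      case 1
      show False using facts 1 j(3) b5 I5 ll d1 by argo
    next
      case 2
      show False using facts 2 j(3) b5 I5 ll d1 d2 d5 by argo
    qed
  qed
qed

section \<open>Words of small complexity have long early repetitions\<close>

context figure_eight
begin

lemma diff_letter_before:
  assumes "i \<in> P" "ty i = b" "i + gap b = p" "j \<in> P" "ty j \<noteq> b" "j + gap (\<not> b) = q"
  shows "x (p - 1) \<noteq> x (q - 1)"
proof -
  have "ty j = (\<not> b)" using assms by auto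
  thus ?thesis using diff_last[of i j] assms by auto
qed

text \<open>
  From \<open>tau\<close> on, the word runs through the loops \<open>b\<close>, \<open>k1\<close> times \<open>b'\<close>, \<open>b\<close>, \<open>k2\<close> times \<open>b'\<close>. If
  \<open>k2 + 2 \<le> k1\<close>, there are two families of right special blocks: suffixes of \<open>b\<close> followed by
  \<open>k2\<close> times \<open>b'\<close>, and suffixes of \<open>k1 - 1\<close> times \<open>b'\<close>.
\<close>

lemma alternating_contradiction:
  fixes s r :: real
  assumes rep: "\<And>L i j. i < j \<Longrightarrow> agree x L i j \<Longrightarrow> n \<le> L \<Longrightarrow> real L \<le> (1 + s) * real j"
    and cpx: "\<And>m. n \<le> m \<Longrightarrow> real (block_complexity m x) \<le> (1 + r) * real m"
    and n: "1000 \<le> n" and s: "0 \<le> s" "0 \<le> r" "s + 3/5 * r \<le> 21/100" "r \<le> 1/3"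
    and alt: "ty (tau + gap (ty tau)) \<noteq> ty tau"
  shows False
proof -
  define b b' where "b = ty tau" and "b' = (\<not> b)"
  define c c' where "c = gap b" and "c' = gap b'"
  define l l' where "l = lam b" and "l' = lam b'"
  have bb': "b \<noteq> b'" "b' \<noteq> b" by (simp_all add: b'_def)
  have pos: "0 < c" "0 < c'" by (simp_all add: c_def c'_def gap_pos)
  have lc: "l < c" "l \<le> tau" "l' < c'" "l' \<le> tau"
    using lam by (auto simp: l_def l'_def c_def c'_def)
  have tauP: "tau \<in> P" by (rule tau(1))
  have tb: "ty tau = b" by (simp add: b_def)
  define o1 where "o1 = tau + c"
  have o1: "o1 \<in> P" using next_occ[OF tauP] by (simp add: o1_def c_def b_def)
  have o1b: "ty o1 = b'" using alt by (auto simp: o1_def c_def b_def b'_def)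
  obtain k1 where k1: "\<And>a. a < k1 \<Longrightarrow> ty (o1 + a * c') = b'" "o1 + k1 * c' \<in> P"
    "ty (o1 + k1 * c') \<noteq> b'" using ex_run[OF o1, of b'] unfolding c'_def by metis
  have k1pos: "0 < k1" using k1(3) o1b by (cases k1) auto
  define o2 where "o2 = o1 + k1 * c'"
  have o2: "o2 \<in> P" "ty o2 = b" using k1 bb' by (auto simp: o2_def b'_def)
  define o3 where "o3 = o2 + c"
  have o3: "o3 \<in> P" using next_occ[OF o2(1)] by (simp add: o3_def o2(2) c_def)
  obtain k2 where k2: "\<And>a. a < k2 \<Longrightarrow> ty (o3 + a * c') = b'" "o3 + k2 * c' \<in> P"
    "ty (o3 + k2 * c') \<noteq> b'" using ex_run[OF o3, of b'] unfolding c'_def by metis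
  have o1run: "o1 + a * c' \<in> P" if "a \<le> k1" for a
    using run_occ[OF o1, of k1 b' a] k1(1) that by (simp add: c'_def)
  define y where "y = (k1 - 1) * c'"
  have y: "y + c' = k1 * c'" using k1pos by (simp add: y_def algebra_simps)
  have k1m: "o1 + (k1 - 1) * c' \<in> P" "ty (o1 + (k1 - 1) * c') = b'"
    using o1run k1(1) k1pos by auto
  have o2': "o2 = o1 + y + c'" using y by (simp add: o2_def)
  have t: "tau = transient + l + l'" using tau_eq by (cases b) (auto simp: l_def l'_def b'_def)
  have ll: "l = 0 \<or> l' = 0" using lam_zero[OF bb'(1)] by (simp add: l_def l'_def)
  have P: "transient + c + c' \<le> block_complexity n x + 1"
    using complexity_ge_loops by (cases b) (auto simp: c_def c'_def b'_def)
  have tr: "transient + n + 1 \<le> block_complexity n x" by (rule complexity_ge_transient)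

  \<comment> \<open>The block at \<open>tau\<close> recurs at the end of the first loop
    \<open>b\<close>; the match extends \<open>l\<close> letters to the left.\<close>
  have 1: "real (n + l) \<le> (1 + s) * real (tau + c - l)"
  proof (rule rep)
    have "agree x n tau o1" using occ_agree tauP o1 by blast
    from agree_lam[OF tauP, of n] this show "agree x (n + l) (tau - l) (tau + c - l)"
      by (simp add: o1_def l_def c_def b_def add.commute)
  qed (use lc in auto)
  \<comment> \<open>The run of \<open>b'\<close> overlaps itself when shifted by one loop.\<close>
  have 2: "real (n + y) \<le> (1 + s) * real (tau + c + c')"
  proof (rule rep)
    have a: "o1 + c' \<in> P" using o1run[of 1] k1pos by simp
    have "agree x ((k1 - 1) * gap b' + n) o1 (o1 + c')"
    proof (rule run_agree[OF o1 _ a])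
      fix i assume "i < k1 - 1"
      thus "ty (o1 + i * gap b') = b'" "ty (o1 + c' + i * gap b') = b'"
        using k1(1)[of i] k1(1)[of "Suc i"] by (auto simp: c'_def add.assoc)
    qed
    thus "agree x (n + y) (tau + c) (tau + c + c')" by (simp add: o1_def y_def c'_def add.commute)
  qed (use pos in auto)
  \<comment> \<open>The block at \<open>tau\<close> recurs at the end of the first loop
    \<open>b'\<close>; the match extends \<open>l'\<close> letters to the left.\<close>
  have 3: "real (n + l') \<le> (1 + s) * real (tau + c + c' - l')"
  proof (rule rep)
    have "o1 + c' \<in> P" using o1run[of 1] k1pos by simp
    hence "agree x n tau (o1 + gap (ty o1))" using occ_agree tauP by (simp add: o1b c'_def)
    from agree_lam[OF o1 this, unfolded o1b] show "agree x (n + l') (tau - l') (tau + c + c' - l')"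
      by (simp add: o1_def l'_def c'_def ac_simps)
  qed (use lc pos in auto)
  \<comment> \<open>\<open>b\<close> followed by \<open>k\<close> loops \<open>b'\<close> is read
    from \<open>tau\<close> and again from \<open>o2\<close>. As \<open>o2\<close> ends a loop
    \<open>b'\<close>, the match extends \<open>l'\<close> letters to the left.\<close>
  have 4: "real (n + l' + c + k * c') \<le> (1 + s) * real (tau + c + c' + y - l')"
    if k: "k \<le> k1" "k \<le> k2" for k
  proof (rule rep)
    have "agree x (k * c' + n) o1 o3"
      unfolding c'_def by (rule run_agree[OF o1 _ o3]) (use k1(1) k2(1) k in \<open>auto simp: c'_def\<close>)
    moreover have "agree x (n + c) tau o2" using same_loop[OF tauP o2(1)] o2(2) tb by (simp add: c_def)
    hence "agree x c tau o2" by (rule agree_mono) simp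
    ultimately have "agree x (c + (k * c' + n)) tau o2"
      unfolding agree_add by (simp add: o1_def o3_def)
    hence "agree x (c + (k * c' + n)) tau (o1 + y + gap b')" by (simp add: o2' c'_def)
    from agree_lam[OF k1m(1), unfolded k1m(2), folded y_def, OF this]
    show "agree x (n + l' + c + k * c') (tau - l') (tau + c + c' + y - l')"
      by (simp add: l'_def c'_def o1_def ac_simps)
  qed (use lc pos in auto)

  have R: "real transient \<le> r * real n" "real transient + real c + real c' \<le> (1 + r) * real n + 1"
    using P tr cpx[of n] by (simp_all add: algebra_simps)
  note A = arith_alternating[of "real n" s r "real transient" "real l" "real l'" "real y" _ "real c" "real c'"]
  have E1: "real n + real l \<le> (1 + s) * (real transient + real l + real l' + real c - real l)"
    using 1 lc by (simp add: t)
  have E2: "real n + real y \<le> (1 + s) * (real transient + real l + real l' + real c + real c')"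
    using 2 by (simp add: t)
  have E3: "real n + real l' \<le> (1 + s) * (real transient + real l + real l' + real c + real c' - real l')"
    using 3 lc by (simp add: t)
  have E4: "real n + real l' + real c + real (k * c') \<le>
      (1 + s) * (real transient + real l + real l' + real c + real c' + real y - real l')"
    if "k \<le> k1" "k \<le> k2" for k
    using 4[OF that] lc by (simp add: t)
  show False
  proof (cases "k1 \<le> k2 + 1")
    case True
    show False
      by (rule A[where z = "real y"]) (use n s lc ll R E1 E2 E3 E4[of "k1 - 1"] True in \<open>auto simp: y_def\<close>)
  next
    case False
    define z where "z = k2 * c'"
    define d where "d = min c (y - z)"
    have zy: "z + c' \<le> y"
    proof -
      have "(k2 + 1) * c' \<le> (k1 - 1) * c'" using False by (intro mult_right_mono) auto
      thus ?thesis by (simp add: z_def y_def)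
    qed
    have "block_complexity (Suc (n + z)) x + 2 * d \<le> block_complexity (Suc (n + z + d)) x"
    proof (rule complexity_two_branches[OF fin])
      have "agree x (k2 * c' + n) o1 o3"
        unfolding c'_def by (rule run_agree[OF o1 _ o3]) (use k1(1) k2(1) False in \<open>auto simp: c'_def\<close>)
      moreover have "agree x (n + c) tau o2" using same_loop[OF tauP o2(1)] o2(2) tb by (simp add: c_def)
      hence "agree x c tau o2" by (rule agree_mono) simp
      ultimately show "agree x (c + (z + n)) tau o2"
        unfolding agree_add[of x c] by (simp add: o1_def o3_def z_def)
      have "ty (o1 + k2 * c') = b'" "o1 + k2 * c' \<in> P" using k1(1) o1run False by auto
      hence "x (o1 + k2 * c' + n) \<noteq> x (o3 + k2 * c' + n)" using diff_loop k2 by metis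
      thus "x (tau + (c + (z + n))) \<noteq> x (o2 + (c + (z + n)))"
        by (simp add: o1_def o3_def z_def ac_simps)
      have a: "o1 + c' \<in> P" using o1run[of 1] k1pos by simp
      have "agree x ((k1 - 1) * gap b' + n) o1 (o1 + c')"
      proof (rule run_agree[OF o1 _ a])
        fix i assume "i < k1 - 1"
        thus "ty (o1 + i * gap b') = b'" "ty (o1 + c' + i * gap b') = b'"
          using k1(1)[of i] k1(1)[of "Suc i"] by (auto simp: c'_def add.assoc)
      qed
      thus "agree x (y + n) o1 (o1 + c')" by (simp add: y_def c'_def)
      have "x (o1 + (k1 - 1) * c' + n) \<noteq> x (o2 + n)"
        using diff_loop[OF k1m(1) o2(1)] k1m(2) o2(2) bb' by simp
      thus "x (o1 + (y + n)) \<noteq> x (o1 + c' + (y + n))" by (simp add: o2' y_def ac_simps)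
      show "n + z + d \<le> c + (z + n)" "n + z + d \<le> y + n" using zy by (auto simp: d_def)
      \<comment> \<open>The letter at distance \<open>Suc (n + z)\<close> from the end closes the
        loop \<open>b\<close> in one block and a loop \<open>b'\<close> in the other;
        \<open>k\<close> loops \<open>b'\<close> precede the latter.\<close>
      define k where "k = k1 - 2 - k2"
      have k: "o1 + k * c' \<in> P" "ty (o1 + k * c') = b'" using o1run k1(1) False by (auto simp: k_def)
      have "k1 - 1 = k2 + Suc k" using False by (simp add: k_def)
      hence yk: "y = z + (k * c' + c')" unfolding y_def z_def by (simp add: algebra_simps)
      have "x (tau + c - 1) \<noteq> x (o1 + k * c' + c' - 1)"
        using diff_letter_before[OF tauP tb _ k(1), of o1] k(2) bb' by (simp add: o1_def c_def c'_def b'_def)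
      moreover have "tau + (c + (z + n)) - Suc (n + z) = tau + c - 1" by simp
      moreover have "o1 + (y + n) - Suc (n + z) = o1 + k * c' + c' - 1" unfolding yk by simp
      ultimately show "x (tau + (c + (z + n)) - Suc (n + z)) \<noteq> x (o1 + (y + n) - Suc (n + z))" by metis
    qed
    \<comment> \<open>The complexity grows by at least 1 per step up to length
      \<open>Suc (n + z)\<close>, then by at least 2 for \<open>d\<close> steps.\<close>
    moreover have "block_complexity n x + (z + 1) \<le> block_complexity (Suc (n + z)) x"
      using complexity_mono_add[of n "z + 1"] by simp
    ultimately have "transient + c + c' + z + 2 * d \<le> block_complexity (Suc (n + z + d)) x"
      using P by linarith
    also have "real \<dots> \<le> (1 + r) * real (Suc (n + z + d))" by (rule cpx) simp
    finally have E5: "real transient + real c + real c' + real z + 2 * real d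
      \<le> (1 + r) * (real n + real z + real d + 1)" by (simp add: ac_simps)
    have dr: "real d = min (real c) (real y - real z)" using zy by (simp add: d_def of_nat_diff)
    have zr: "real z \<le> real y - real c'" using zy by simp
    have "real n + real l' + real c + real z \<le>
      (1 + s) * (real transient + real l + real l' + real c + real c' + real y - real l')"
      using E4[of k2] False by (simp add: z_def)
    note facts = this E5 dr zr E1 E2 E3 R n s lc ll
    show False
      by (rule A[where z = "real z" and e = "real d"]) (use facts in \<open>auto\<close>)
  qed
qed

text \<open>
  Here the loop \<open>b\<close> is taken \<open>k \<ge> 2\<close> times and then \<open>b'\<close>. If \<open>b'\<close> is repeated as well, both the
  suffixes of \<open>b'\<close> and those of \<open>k - 1\<close> times \<open>b\<close> are right special.
\<close>

lemma repeating_contradiction: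
  fixes s r :: real
  assumes rep: "\<And>L i j. i < j \<Longrightarrow> agree x L i j \<Longrightarrow> n \<le> L \<Longrightarrow> real L \<le> (1 + s) * real j"
    and cpx: "\<And>m. n \<le> m \<Longrightarrow> real (block_complexity m x) \<le> (1 + r) * real m"
    and n: "1000 \<le> n" and s: "0 \<le> s" "0 \<le> r" "s + 3/5 * r \<le> 21/100" "r \<le> 1/3"
    and alt: "ty (tau + gap (ty tau)) = ty tau"
  shows False
proof -
  define b b' where "b = ty tau" and "b' = (\<not> b)"
  define c c' where "c = gap b" and "c' = gap b'"
  define l l' where "l = lam b" and "l' = lam b'"
  have bb': "b \<noteq> b'" "b' \<noteq> b" by (simp_all add: b'_def)
  have pos: "0 < c" "0 < c'" by (simp_all add: c_def c'_def gap_pos)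
  have lc: "l < c" "l \<le> tau" "l' < c'" "l' \<le> tau"
    using lam by (auto simp: l_def l'_def c_def c'_def)
  have tauP: "tau \<in> P" by (rule tau(1))
  have tb: "ty tau = b" by (simp add: b_def)
  obtain k where k: "\<And>a. a < k \<Longrightarrow> ty (tau + a * c) = b" "tau + k * c \<in> P"
    "ty (tau + k * c) \<noteq> b" using ex_run[OF tauP, of b] unfolding c_def by metis
  have "k \<noteq> 0" using k(3) tb by (cases k) auto
  moreover have "k \<noteq> 1" using k(3) alt by (auto simp: c_def b_def)
  ultimately have k2: "2 \<le> k" by simp
  have run: "tau + a * c \<in> P" if "a \<le> k" for a
    using run_occ[OF tauP, of k b a] k(1) that by (simp add: c_def)
  define y where "y = (k - 1) * c"
  have y: "y + c = k * c" using k2 by (simp add: y_def algebra_simps)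
  have "1 * c \<le> (k - 1) * c" using k2 by (intro mult_right_mono) auto
  hence cy: "c \<le> y" by (simp add: y_def)
  define o1 where "o1 = tau + k * c"
  have o1: "o1 \<in> P" "ty o1 = b'" using k by (auto simp: o1_def b'_def)
  have o1': "o1 = tau + y + c" using y by (simp add: o1_def)
  define o2 where "o2 = o1 + c'"
  have o2: "o2 \<in> P" using next_occ[OF o1(1)] by (simp add: o2_def o1(2) c'_def)
  have t: "tau = transient + l + l'" using tau_eq by (cases b) (auto simp: l_def l'_def b'_def)
  have ll: "l = 0 \<or> l' = 0" using lam_zero[OF bb'(1)] by (simp add: l_def l'_def)
  have P: "transient + c + c' \<le> block_complexity n x + 1"
    using complexity_ge_loops by (cases b) (auto simp: c_def c'_def b'_def)
  have tr: "transient + n + 1 \<le> block_complexity n x" by (rule complexity_ge_transient)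
  have self: "agree x (y + n) tau (tau + c)"
  proof -
    have a: "tau + c \<in> P" using run[of 1] k2 by simp
    have "agree x ((k - 1) * gap b + n) tau (tau + c)"
    proof (rule run_agree[OF tauP _ a])
      fix i assume "i < k - 1"
      thus "ty (tau + i * gap b) = b" "ty (tau + c + i * gap b) = b"
        using k(1)[of i] k(1)[of "Suc i"] by (auto simp: c_def add.assoc)
    qed
    thus ?thesis by (simp add: y_def c_def)
  qed
  \<comment> \<open>The first run of \<open>b\<close> overlaps itself shifted by one loop, and the
    match extends \<open>l\<close> letters to the left.\<close>
  have 1: "real (n + y + l) \<le> (1 + s) * real (tau + c - l)"
  proof (rule rep)
    from agree_lam[OF tauP, of "y + n"] self show "agree x (n + y + l) (tau - l) (tau + c - l)"
      by (simp add: l_def c_def b_def ac_simps)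
  qed (use lc in auto)
  \<comment> \<open>\<open>o2\<close> ends a loop \<open>b'\<close>, so a match with
    \<open>tau\<close> extends \<open>l'\<close> letters to the left. The choice
    \<open>m = 0\<close> is always possible, and \<open>m = c\<close> if \<open>o2\<close> starts a
    loop \<open>b\<close>.\<close>
  have 2: "real (n + l' + m) \<le> (1 + s) * real (tau + y + c + c' - l')" if "agree x (n + m) tau o2" for m
  proof (rule rep)
    have "agree x (n + m) tau (o1 + gap (ty o1))" using that by (simp add: o1 o2_def c'_def)
    from agree_lam[OF o1(1) this, unfolded o1(2)] show "agree x (n + l' + m) (tau - l') (tau + y + c + c' - l')"
      by (simp add: o1' l'_def c'_def ac_simps)
  qed (use lc pos in auto)
  have R: "real transient \<le> r * real n" "real transient + real c + real c' \<le> (1 + r) * real n + 1"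
    using P tr cpx[of n] by (simp_all add: algebra_simps)
  note A = arith_repeating[of "real n" s r "real transient" "real l" "real l'" "real c" "real c'" "real y"]
  have E1: "real n + real y + real l \<le> (1 + s) * (real transient + real l + real l' + real c - real l)"
    using 1 lc by (simp add: t)
  have E: "real n + real l' + real m \<le>
      (1 + s) * (real transient + real l + real l' + real y + real c + real c' - real l')"
    if "agree x (n + m) tau o2" for m
    using 2[OF that] lc by (simp add: t)
  have "agree x (n + 0) tau o2" using occ_agree tauP o2 by simp
  from E[OF this] have E2: "real n + real l' \<le>
      (1 + s) * (real transient + real l + real l' + real y + real c + real c' - real l')" by simp
  show False
  proof (cases "ty o2 = b")
    case True
    have "agree x (n + c) tau o2" using same_loop[OF tauP o2] True tb by (simp add: c_def)
    note facts = E[OF this] E1 E2 R n s lc ll cy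
    show False by (rule A) (use facts in auto)
  next
    case False
    hence o2b: "ty o2 = b'" by (auto simp: b'_def)
    obtain h where h: "\<And>a. a < h \<Longrightarrow> ty (o1 + a * c') = b'" "o1 + h * c' \<in> P"
      "ty (o1 + h * c') \<noteq> b'" using ex_run[OF o1(1), of b'] unfolding c'_def by metis
    have "h \<noteq> 0" using h(3) o1 by (cases h) auto
    \<comment> \<open>\<open>o3\<close> starts the last loop of the run of \<open>b'\<close>. After
      this loop comes \<open>b\<close>, whereas the loop at \<open>o1\<close> is followed by
      \<open>b'\<close>: the block they share is right special.\<close>
    define o3 where "o3 = o1 + (h - 1) * c'"
    have o3: "o3 \<in> P" "ty o3 = b'" "o3 + c' \<in> P" "ty (o3 + c') \<noteq> b'"
    proof -
      show "o3 \<in> P" using run_occ[OF o1(1), of h b' "h - 1"] h(1) by (simp add: o3_def c'_def)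
      show "ty o3 = b'" using h(1) \<open>h \<noteq> 0\<close> by (simp add: o3_def)
      have "o3 + c' = o1 + h * c'" using \<open>h \<noteq> 0\<close> by (cases h) (auto simp: o3_def)
      thus "o3 + c' \<in> P" "ty (o3 + c') \<noteq> b'" using h by auto
    qed
    define d where "d = min c' y"
    have "block_complexity (Suc n) x + 2 * d \<le> block_complexity (Suc (n + d)) x"
    proof (rule complexity_two_branches[OF fin])
      show "agree x (n + c') o1 o3" using same_loop[OF o1(1) o3(1)] o1 o3 by (simp add: c'_def)
      have "x (o2 + n) \<noteq> x (o3 + c' + n)" using diff_loop[OF o2 o3(3)] o2b o3(4) by simp
      thus "x (o1 + (n + c')) \<noteq> x (o3 + (n + c'))" by (simp add: o2_def ac_simps)
      show "agree x (y + n) tau (tau + c)" by (rule self)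
      have k1: "tau + y \<in> P" "ty (tau + y) = b" using run[of "k - 1"] k(1)[of "k - 1"] k2 by (auto simp: y_def)
      have "x (tau + y + n) \<noteq> x (o1 + n)"
        using diff_loop[OF k1(1) o1(1)] k1(2) o1(2) bb' by simp
      thus "x (tau + (y + n)) \<noteq> x (tau + c + (y + n))" by (simp add: o1' ac_simps)
      show "n + d \<le> n + c'" "n + d \<le> y + n" by (auto simp: d_def)
      define p where "p = tau + (k - 2) * c"
      have p: "p \<in> P" "ty p = b" using run[of "k - 2"] k(1)[of "k - 2"] k2 by (auto simp: p_def)
      have "k - 1 = Suc (k - 2)" using k2 by simp
      hence "tau + y = p + c" unfolding y_def p_def by simp
      hence "x (tau + y - 1) \<noteq> x (o1 + c' - 1)"
        using diff_letter_before[OF p _ o1(1), of "tau + y"] o1(2) bb' by (simp add: c_def c'_def b'_def)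
      thus "x (o1 + (n + c') - Suc n) \<noteq> x (tau + (y + n) - Suc n)" using pos cy by (simp add: eq_commute)
    qed
    moreover have "block_complexity n x + 1 \<le> block_complexity (Suc n) x" by (rule complexity_strict_mono)
    ultimately have "transient + c + c' + 2 * d \<le> block_complexity (Suc (n + d)) x"
      using P by linarith
    also have "real \<dots> \<le> (1 + r) * real (Suc (n + d))" by (rule cpx) simp
    finally have E5: "real transient + real c + real c' + 2 * real d
      \<le> (1 + r) * (real n + real d + 1)" by (simp add: ac_simps)
    have dr: "real d = min (real c') (real y)" by (simp add: d_def)
    note facts = E5 dr E1 E2 R n s lc ll cy
    show False by (rule A[where e = "real d"]) (use facts in auto)
  qed
qed

end

section \<open>Choice of the order and the combined contradiction\<close>

context aperiodic_word
begin

text \<open>Otherwise the complexity would eventually grow with slope at least 2, which exceeds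
  \<open>\<rho>\<close>.\<close>

lemma ex_complexity_Suc_eq:
  assumes "\<rho> < 2" and "\<And>m. N \<le> m \<Longrightarrow> real (block_complexity m x) \<le> \<rho> * real m"
  shows "\<exists>n\<ge>N. block_complexity (Suc n) x = block_complexity n x + 1"
proof (rule ccontr)
  assume no: "\<not> ?thesis"
  have step: "block_complexity n x + 2 \<le> block_complexity (Suc n) x" if "N \<le> n" for n
  proof -
    have "block_complexity (Suc n) x \<noteq> block_complexity n x + 1" using no that by blast
    thus ?thesis using complexity_strict_mono[of n] by simp
  qed
  have ge: "2 * k \<le> block_complexity (N + k) x" for k
  proof (induction k)
    case (Suc k)
    thus ?case using step[of "N + k"] by simp
  qed simp
  obtain k :: nat where k: "\<rho> * real N / (2 - \<rho>) < real k" using reals_Archimedean2 by blast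
  have "2 * real k \<le> \<rho> * real (N + k)" using ge[of k] assms(2)[of "N + k"] by simp
  hence "(2 - \<rho>) * real k \<le> \<rho> * real N" by (simp add: algebra_simps)
  thus False using k assms(1) by (simp add: divide_less_eq mult.commute)
qed

theorem no_small_complexity_and_repetition:
  fixes s r :: real
  assumes rep: "\<And>L i j. i < j \<Longrightarrow> agree x L i j \<Longrightarrow> N \<le> L \<Longrightarrow> real L \<le> (1 + s) * real j"
    and cpx: "\<And>m. N \<le> m \<Longrightarrow> real (block_complexity m x) \<le> (1 + r) * real m"
    and s: "0 \<le> s" "0 \<le> r" "s + 3/5 * r \<le> 21/100" "r \<le> 1/3"
  shows False
proof -
  obtain n0 where n0: "max N 1000 \<le> n0" "block_complexity (Suc n0) x = block_complexity n0 x + 1"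
    using ex_complexity_Suc_eq[of "1 + r" "max N 1000"] cpx s by auto
  obtain n P gap ty where n: "n0 \<le> n" "figure_eight x n P gap ty"
    using figure_eight_exists[OF n0(2)] by blast
  interpret figure_eight x n P gap ty by (rule n)
  have n: "N \<le> n" "1000 \<le> n" using n0 n by auto
  have rep': "real L \<le> (1 + s) * real j" if "i < j" "agree x L i j" "n \<le> L" for L i j
    using rep that n(1) by simp
  have cpx': "real (block_complexity m x) \<le> (1 + r) * real m" if "n \<le> m" for m
    using cpx that n(1) by simp
  show False
  proof (cases "ty (tau + gap (ty tau)) = ty tau")
    case True
    show False by (rule repeating_contradiction[OF _ _ n(2) s True]) (use rep' cpx' in auto)
  next
    case False
    show False by (rule alternating_contradiction[OF _ _ n(2) s False]) (use rep' cpx' in auto)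
  qed
qed

end

section \<open>Rational approximations from repetitions\<close>

lemma expansion_less:
  assumes "b \<ge> 2"
  shows "expansion b \<xi> j < b"
proof -
  have "expansion b \<xi> j \<in> {0..b - 1}"
    using is_expansion_expansion[OF assms, of \<xi>] by (simp add: is_expansion_def)
  thus ?thesis using assms by simp
qed

lemma floor_power_Suc:
  assumes b: "b \<ge> 2"
  shows "\<lfloor>real b ^ Suc n * frac \<xi>\<rfloor> = int b * \<lfloor>real b ^ n * frac \<xi>\<rfloor> + int (expansion b \<xi> n)"
proof -
  define F where "F m = \<lfloor>real b ^ m * frac \<xi>\<rfloor>" for m
  have "F n = \<lfloor>(real b ^ Suc n * frac \<xi>) / real b\<rfloor>" using b by (simp add: F_def)
  also have "\<dots> = F (Suc n) div int b"
    unfolding F_def by (metis floor_divide_real_eq_div of_int_of_nat_eq of_nat_0_le_iff)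
  finally have "F n = F (Suc n) div int b" .
  moreover have "int (expansion b \<xi> n) = F (Suc n) mod int b"
    using expansion_unique_digit[OF b is_expansion_expansion[OF b], of \<xi> n] b by (simp add: F_def)
  ultimately show ?thesis by (simp add: F_def[symmetric] del: power_Suc)
qed

text \<open>The digits from position \<open>i\<close> on are those of \<open>b\<^sup>i \<xi>\<close>, so \<open>b\<^sup>i \<xi>\<close> and \<open>b\<^sup>j \<xi>\<close> are close modulo 1.\<close>

lemma approximation_of_repetition:
  assumes b: "b \<ge> 2" and ag: "agree (expansion b \<xi>) L i j"
  shows "\<exists>p::int. \<bar>(real b ^ j - real b ^ i) * \<xi> - real_of_int p\<bar> < 1 / real b ^ L"
proof -
  define F where "F m = \<lfloor>real b ^ m * frac \<xi>\<rfloor>" for m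
  \<comment> \<open>Both sides are the integer whose base \<open>b\<close> digits form the common
    block of length \<open>L\<close>.\<close>
  have eq: "F (i + L) - int b ^ L * F i = F (j + L) - int b ^ L * F j"
    using ag
  proof (induction L)
    case (Suc L)
    hence IH: "F (i + L) - int b ^ L * F i = F (j + L) - int b ^ L * F j"
      and d: "expansion b \<xi> (i + L) = expansion b \<xi> (j + L)" by (auto simp: agree_Suc)
    have *: "F (m + Suc L) - int b ^ Suc L * F m
        = int b * (F (m + L) - int b ^ L * F m) + int (expansion b \<xi> (m + L))" for m
      using floor_power_Suc[OF b, of "m + L" \<xi>] by (simp add: F_def algebra_simps)
    show ?case unfolding * IH d ..
  qed simp
  have frac: "0 \<le> real b ^ L * (real b ^ m * frac \<xi>) - real_of_int (F (m + L))"
     "real b ^ L * (real b ^ m * frac \<xi>) - real_of_int (F (m + L)) < 1" for m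
    unfolding F_def by (simp_all add: power_add mult_ac) linarith
  define t where "t = (real b ^ j - real b ^ i) * frac \<xi> - real_of_int (F j - F i)"
  have "real_of_int (F (j + L)) - real_of_int (F (i + L)) = real b ^ L * real_of_int (F j - F i)"
    using arg_cong[OF eq, of real_of_int] by (simp add: algebra_simps)
  hence "real b ^ L * t = (real b ^ L * (real b ^ j * frac \<xi>) - real_of_int (F (j + L)))
      - (real b ^ L * (real b ^ i * frac \<xi>) - real_of_int (F (i + L)))"
    by (simp add: t_def algebra_simps)
  hence "\<bar>real b ^ L * t\<bar> < 1" using frac[of i] frac[of j] by linarith
  hence "\<bar>t\<bar> < 1 / real b ^ L" using b by (simp add: abs_mult field_simps)
  moreover have "t = (real b ^ j - real b ^ i) * \<xi> -
      real_of_int ((int b ^ j - int b ^ i) * \<lfloor>\<xi>\<rfloor> + (F j - F i))"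
    by (simp add: t_def frac_def algebra_simps)
  ultimately show ?thesis by metis
qed

text \<open>A longer repetition would make the fraction with denominator
  \<open>b ^ j - b ^ i\<close> one of the finitely many approximations of exponent
  \<open>\<kappa>\<close>. For large \<open>L\<close> it is closer to \<open>\<xi>\<close> than all
  of these.\<close>

lemma repetition_bound:
  assumes b: "b \<ge> 2" and irr: "\<xi> \<notin> \<rat>"
    and \<kappa>: "irrationality_exponent \<xi> < ereal \<kappa>" "1 \<le> \<kappa>"
  shows "\<exists>N. \<forall>L i j. i < j \<longrightarrow> agree (expansion b \<xi>) L i j \<longrightarrow> N \<le> L \<longrightarrow>
    real L \<le> (\<kappa> - 1) * real j"
proof -
  define S where "S = {real_of_int p / real q | (p :: int) (q :: nat).
         q \<ge> 1 \<and> \<bar>\<xi> - real_of_int p / real q\<bar> < real q powr (- \<kappa>)}"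
  have "finite S"
  proof (rule ccontr)
    assume "infinite S"
    hence "ereal \<kappa> \<le> irrationality_exponent \<xi>"
      unfolding irrationality_exponent_def S_def by (intro Sup_upper) blast
    thus False using \<kappa> by simp
  qed
  \<comment> \<open>The distance from \<open>\<xi>\<close> to \<open>S\<close> is positive by
    irrationality; inserting 1 covers an empty \<open>S\<close>.\<close>
  define \<delta> where "\<delta> = Min (insert 1 ((\<lambda>r. \<bar>\<xi> - r\<bar>) ` S))"
  have S_rat: "r \<in> \<rat>" if "r \<in> S" for r using that by (auto simp: S_def)
  have "0 < \<delta>" unfolding \<delta>_def using \<open>finite S\<close> S_rat irr by (subst Min_gr_iff) auto
  have \<delta>: "\<delta> \<le> \<bar>\<xi> - r\<bar>" if "r \<in> S" for r
    unfolding \<delta>_def by (rule Min_le) (use that \<open>finite S\<close> in auto)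
  obtain N where N: "(1 / real b) ^ N < \<delta>"
    using real_arch_pow_inv[OF \<open>0 < \<delta>\<close>, of "1 / real b"] b by auto
  show ?thesis
  proof (intro exI allI impI)
    fix L i j :: nat
    assume ij: "i < j" and ag: "agree (expansion b \<xi>) L i j" and L: "N \<le> L"
    define q where "q = b ^ j - b ^ i"
    have "b ^ i < b ^ j" using ij b by (intro power_strict_increasing) auto
    hence q: "1 \<le> q" "real q = real b ^ j - real b ^ i" "q \<le> b ^ j"
      by (auto simp: q_def of_nat_diff)
    obtain p :: int where p: "\<bar>real q * \<xi> - real_of_int p\<bar> < 1 / real b ^ L"
      using approximation_of_repetition[OF b ag] q(2) by auto
    have "\<xi> - real_of_int p / real q = (real q * \<xi> - real_of_int p) / real q"
      using q(1) by (simp add: field_simps)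
    hence "\<bar>\<xi> - real_of_int p / real q\<bar> = \<bar>real q * \<xi> - real_of_int p\<bar> / real q" by simp
    also have "\<dots> < 1 / real b ^ L / real q" using p q(1) by (intro divide_strict_right_mono) auto
    finally have close: "\<bar>\<xi> - real_of_int p / real q\<bar> < 1 / real b ^ L / real q" .
    have "1 / real b ^ L / real q \<le> 1 / real b ^ L / 1"
      using q(1) b by (intro divide_left_mono) auto
    also have "\<dots> \<le> (1 / real b) ^ N"
      using L b by (simp add: power_divide frac_le power_increasing)
    finally have "\<bar>\<xi> - real_of_int p / real q\<bar> < \<delta>" using close N by linarith
    hence "real_of_int p / real q \<notin> S" using \<delta> by fastforce
    hence far: "real q powr (- \<kappa>) \<le> \<bar>\<xi> - real_of_int p / real q\<bar>"
      using q(1) by (auto simp: S_def not_less)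
    show "real L \<le> (\<kappa> - 1) * real j"
    proof (rule ccontr)
      assume "\<not> ?thesis"
      hence "real b powr (- real L) \<le> real b powr (- ((\<kappa> - 1) * real j))"
        using b by (intro powr_mono) auto
      also have "\<dots> = (real b ^ j) powr (- (\<kappa> - 1))"
        using b by (simp add: powr_realpow[symmetric] powr_powr algebra_simps)
      also have "\<dots> \<le> real q powr (- (\<kappa> - 1))"
        using q \<kappa>(2) by (intro powr_mono2') (auto simp flip: of_nat_power)
      finally have "1 / real b ^ L \<le> real q powr (- (\<kappa> - 1))"
        using b by (simp add: powr_minus powr_realpow divide_inverse)
      hence "1 / real b ^ L / real q \<le> real q powr (- (\<kappa> - 1)) / real q"
        using q(1) by (intro divide_right_mono) auto
      also have "\<dots> = real q powr (- \<kappa>)"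
        using q(1) powr_diff[of "real q" "- (\<kappa> - 1)" 1] by simp
      finally show False using far close by linarith
    qed
  qed
qed

section \<open>The bound for the limsup and the curve of the theorem\<close>

lemma complexity_limsup_ge:
  assumes b: "b \<ge> 2" and irr: "\<xi> \<notin> \<rat>" and \<mu>: "irrationality_exponent \<xi> = ereal \<mu>"
    and V: "V \<le> 4/3" "1 < V \<Longrightarrow> \<mu> - 2 + 3/5 * (V - 1) \<le> 21/100"
  shows "ereal V \<le> limsup (\<lambda>n. ereal (real (real_complexity n \<xi> b) / real n))"
proof (rule ccontr)
  let ?x = "expansion b \<xi>"
  assume "\<not> ?thesis"
  hence "limsup (\<lambda>n. ereal (real (real_complexity n \<xi> b) / real n)) < ereal V" by simp
  from ereal_dense2[OF this] obtain \<rho> where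
    \<rho>: "limsup (\<lambda>n. ereal (real (real_complexity n \<xi> b) / real n)) < ereal \<rho>" "\<rho> < V"
    by auto
  have "eventually (\<lambda>n. ereal (real (real_complexity n \<xi> b) / real n) < ereal \<rho>) sequentially"
    by (rule Limsup_lessD[OF \<rho>(1)])
  then obtain N0 where N0: "\<And>n. N0 \<le> n \<Longrightarrow> real (block_complexity n ?x) / real n < \<rho>"
    unfolding eventually_sequentially real_complexity_def by auto
  define r where "r = max 0 (\<rho> - 1)"
  define N1 where "N1 = max N0 1"
  have cpx: "real (block_complexity n ?x) \<le> (1 + r) * real n" if "N1 \<le> n" for n
  proof -
    have "real (block_complexity n ?x) \<le> \<rho> * real n"
      using N0[of n] that by (simp add: N1_def divide_less_eq split: if_splits)
    also have "\<dots> \<le> (1 + r) * real n" by (rule mult_right_mono) (auto simp: r_def)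
    finally show ?thesis .
  qed
  \<comment> \<open>For \<open>1 < V\<close> the pair \<open>(r, s)\<close> lies on the line
    \<open>s + 3/5 * r = 21/100\<close>, and \<open>r < V - 1\<close> yields the strict inequality
    \<open>\<mu> < 2 + s\<close>. Otherwise \<open>s\<close> only has to be nonnegative and satisfy
    that inequality.\<close>
  define s where "s = (if 1 < V then 21/100 - 3/5 * r else max 0 (\<mu> - 1))"
  have r: "0 \<le> r" "1 < V \<Longrightarrow> r < V - 1" using \<rho>(2) by (auto simp: r_def)
  have s0: "0 \<le> s \<and> \<mu> < 2 + s"
  proof (cases "1 < V")
    case True
    hence "s = 21/100 - 3/5 * r" by (simp add: s_def)
    thus ?thesis using V(1) V(2)[OF True] r(2)[OF True] by argo
  qed (simp add: s_def)
  have "irrationality_exponent \<xi> < ereal (2 + s)" using s0 \<mu> by simp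
  from repetition_bound[OF b irr this] s0 obtain N2 where
    N2: "\<And>L i j. i < j \<Longrightarrow> agree ?x L i j \<Longrightarrow> N2 \<le> L \<Longrightarrow> real L \<le> (1 + s) * real j"
    by (auto simp: algebra_simps)
  \<comment> \<open>Aperiodicity follows from the repetition bound: for fixed \<open>i < j\<close>
    the length of an agreement is bounded.\<close>
  have word: "aperiodic_word ?x"
  proof
    show "finite (range ?x)"
      by (rule finite_subset[of _ "{..<b}"]) (use expansion_less[OF b] in auto)
    fix i j :: nat assume ij: "i < j"
    obtain L :: nat where L: "max (real N2) ((1 + s) * real j) < real L" using reals_Archimedean2 by blast
    hence "\<not> agree ?x L i j" using N2[OF ij, of L] by auto
    thus "\<exists>n. \<not> agree ?x n i j" ..
  qed
  show False
  proof (cases "1 < V")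
    case True
    show False
    proof (rule aperiodic_word.no_small_complexity_and_repetition[OF word, of "max N1 N2" s r])
      show "real L \<le> (1 + s) * real j" if "i < j" "agree ?x L i j" "max N1 N2 \<le> L" for L i j
        using N2 that by simp
      show "real (block_complexity m ?x) \<le> (1 + r) * real m" if "max N1 N2 \<le> m" for m
        using cpx that by simp
    qed (use s0 r(1) r(2)[OF True] V(1) True in \<open>simp_all add: s_def\<close>)
  next
    case False
    \<comment> \<open>For \<open>V \<le> 1\<close> the bound \<open>n + 1\<close> for aperiodic
      words is enough.\<close>
    hence "r = 0" using \<rho>(2) by (simp add: r_def)
    thus False using cpx[of N1] aperiodic_word.complexity_ge[OF word, of N1] by simp
  qed
qed

text \<open>With \<open>s = \<mu> - 2\<close> the bound of the theorem is \<open>1 + v\<close>. The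
  tangent \<open>3 - 5/3 * s\<close> at 0 lies below the square root, which gives
  \<open>1/3\<close>. Positivity of \<open>v\<close> forces \<open>s < 1/5\<close>, and in this
  range the line lies above the curve.\<close>

lemma bound_curve:
  fixes s :: real
  assumes "0 < s"
  defines "v \<equiv> (s + 3 - sqrt (81 * s\<^sup>2 - 10 * s + 9)) / (8 * s)"
  shows "v \<le> 1/3" "0 < v \<Longrightarrow> s + 3/5 * v \<le> 21/100"
proof -
  define D where "D = 81 * s\<^sup>2 - 10 * s + 9"
  have v: "v = (s + 3 - sqrt D) / (8 * s)" by (simp add: v_def D_def)
  have "(3 - 5/3 * s)\<^sup>2 \<le> D" by (simp add: D_def power2_eq_square algebra_simps)
  hence "3 - 5/3 * s \<le> sqrt D" by (rule real_le_rsqrt)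
  thus "v \<le> 1/3" using assms(1) by (simp add: v field_simps)
  assume "0 < v"
  hence lt: "sqrt D < s + 3" using assms(1) by (simp add: v zero_less_divide_iff)
  have "D < (s + 3)\<^sup>2" using lt assms(1) by (smt (verit) real_sqrt_less_iff real_sqrt_pow2 real_sqrt_abs sqrt_le_D)
  hence "s * (80 * s) < s * 16" by (simp add: D_def power2_eq_square algebra_simps)
  hence s: "s < 1/5" using assms(1) by simp
  \<comment> \<open>This polynomial equals \<open>s + 3 - 8 * s * v\<close> when \<open>v\<close> is
    taken on the line, so the square root must be at least as large.\<close>
  have "(3 - 9/5 * s + 40/3 * s\<^sup>2)\<^sup>2 \<le> D"
  proof -
    have "D - (3 - 9/5 * s + 40/3 * s\<^sup>2)\<^sup>2 = s * (4/5 - 56/25 * s + 48 * s\<^sup>2 - 1600/9 * (s * s\<^sup>2))"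
      by (simp add: D_def power2_eq_square algebra_simps)
    moreover have "s * s\<^sup>2 \<le> 1/5 * s\<^sup>2" using s by (intro mult_right_mono) auto
    hence "0 \<le> 4/5 - 56/25 * s + 48 * s\<^sup>2 - 1600/9 * (s * s\<^sup>2)" using s zero_le_power2[of s] by linarith
    hence "0 \<le> s * (4/5 - 56/25 * s + 48 * s\<^sup>2 - 1600/9 * (s * s\<^sup>2))" using assms(1) by simp
    ultimately show ?thesis by simp
  qed
  hence "3 - 9/5 * s + 40/3 * s\<^sup>2 \<le> sqrt D" by (rule real_le_rsqrt)
  hence "s + 3 - sqrt D \<le> (21/100 - s) * (5/3) * (8 * s)" by (simp add: power2_eq_square algebra_simps)
  hence "v \<le> (21/100 - s) * (5/3)" using assms(1) by (simp add: v divide_le_eq)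
  thus "s + 3/5 * v \<le> 21/100" by simp
qed

theorem theorem1p3:
  fixes b :: nat and \<xi> \<mu> :: real
  assumes "b \<ge> 2" and "\<xi> \<notin> \<rat>" and "irrationality_exponent \<xi> = ereal \<mu>"
  shows "(\<mu> = 2 \<longrightarrow>
            limsup (\<lambda>n. ereal (real (real_complexity n \<xi> b) / real n)) \<ge> ereal (4 / 3)) \<and>
         (\<mu> > 2 \<longrightarrow>
            limsup (\<lambda>n. ereal (real (real_complexity n \<xi> b) / real n)) \<ge>
              ereal (1 + (\<mu> + 1 - sqrt (81 * (\<mu> - 2)\<^sup>2 - 10 * \<mu> + 29)) / (8 * (\<mu> - 2))))"
proof (intro conjI impI)
  assume "\<mu> = 2"
  \<comment> \<open>For \<open>V = 4/3\<close> the condition reads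
    \<open>1/5 \<le> 21/100\<close>.\<close>
  thus "ereal (4 / 3) \<le> limsup (\<lambda>n. ereal (real (real_complexity n \<xi> b) / real n))"
    by (intro complexity_limsup_ge[OF assms]) auto
next
  assume "2 < \<mu>"
  define s where "s = \<mu> - 2"
  have "0 < s" using \<open>2 < \<mu>\<close> by (simp add: s_def)
  have eq: "81 * (\<mu> - 2)\<^sup>2 - 10 * \<mu> + 29 = 81 * s\<^sup>2 - 10 * s + 9" "\<mu> + 1 = s + 3"
    by (simp_all add: s_def)
  define v where "v = (s + 3 - sqrt (81 * s\<^sup>2 - 10 * s + 9)) / (8 * s)"
  have v: "v \<le> 1/3" "0 < v \<Longrightarrow> s + 3/5 * v \<le> 21/100"
    using bound_curve[OF \<open>0 < s\<close>] by (simp_all add: v_def)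
  have "ereal (1 + v) \<le> limsup (\<lambda>n. ereal (real (real_complexity n \<xi> b) / real n))"
    by (rule complexity_limsup_ge[OF assms]) (use v in \<open>auto simp: s_def\<close>)
  thus "ereal (1 + (\<mu> + 1 - sqrt (81 * (\<mu> - 2)\<^sup>2 - 10 * \<mu> + 29)) / (8 * (\<mu> - 2)))
      \<le> limsup (\<lambda>n. ereal (real (real_complexity n \<xi> b) / real n))"
    unfolding eq v_def by (simp only: s_def)
qed

end
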